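(* Let $\mathfrak g=\mathfrak e_6$, let $V$ be its $27$-dimensional irreducible representation with highest weight $(0,0,0,0,0,1)$, and let $I=I_{(\mathfrak e_6,V)}$ be the associated invariant of oriented framed coloured $3$-tangles. Denote by $X_+,\mathrm{Id},\mathrm{H},\mathrm{H}_{do}$ the elementary oriented tangles described in the context, by $r,s$ the normalisation factors of $\mathrm H$ and $\mathrm H_{do}$, and put $q=e^{-\hat h^2/(72h)}$. Then the following skein relation, involving only one crossing, holds in $\mathrm{End}_{\mathfrak e_6}(V\otimes V)\otimes_{\mathbf C}\mathbf C((\hat h))$: $$I(X_+)=\lambda\, I(\mathrm{Id})+\mu\, I(\mathrm{H})+\rho\, I(\mathrm{H}_{do}),$$ where $$\lambda=-q^{-1},\qquad \mu=\frac{q^{-1}+q^{-13}}{r},\qquad \rho=\frac{q^{-1}+q^{2}}{s}.$$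
   Context: An oriented framed coloured $3$-tangle is an oriented framed tangle in which trivalent branching points are allowed and whose edges are coloured by solid, dashed or dotted. The invariant $I_{(\mathfrak g,V)}=\Psi_{\mathfrak g}\circ\hat Z_f$ is the composite of the universal Vassiliev–Kontsevich invariant $\hat Z_f$ (extended to coloured $3$-tangles) with the $(\mathfrak g,V)$-weight system $\Psi_{\mathfrak g}$; it is a monoidal functor with values in $\mathfrak g$-linear maps between tensor products of representations, with coefficients in $\mathbf C[[\hat h]]$ ($\hat h$ a formal parameter). For $\mathfrak g=\mathfrak e_6$, solid strands are sent to $V$ or $V^*$ according to orientation, dashed strands to the adjoint representation $L$, dotted strands to $U$ or $U^*$ according to orientation. Decomposition: $V\otimes V\cong U\oplus V^*\oplus W$ with highest weights (Bourbaki/Humphreys numbering) $V:(0,0,0,0,0,1)$, $V^*:(1,0,0,0,0,0)$, $U:(0,0,0,0,0,2)$, $W:(0,0,0,0,1,0)$; the symmetric square is $U\oplus V^*$ and the exterior square is $W$. The summands are pairwise non-isomorphic; $\pi_Y$ denotes the projection of $V\otimes V$ onto the summand $Y$. Weight system normalisation: $h$ is a fixed non-zero complex number, the pairing on $L$ is $h\kappa$ with $\kappa$ the Killing form, and every trivalent vertex meeting a dashed edge carries a factor $\hat h$. Thus a dashed chord joining two parallel solid strands is sent to $\Theta=\frac{\hat h^2}{h}\,\Omega\in\mathrm{End}_{\mathfrak g}(V\otimes V)[[\hat h]]$, where $\Omega=\sum_a x_a\otimes x^a$ for dual bases $(x_a),(x^a)$ of $\mathfrak g$ with respect to $\kappa$.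 Values of $I$ on the elementary tangles with two incoming and two outgoing solid ends (all viewed as endomorphisms of $V\otimes V$): - $X_+$ (positive crossing), both strands oriented in parallel: $I(X_+)=\tau\circ e^{-\Theta/2}$, where $\tau(x\otimes y)=y\otimes x$. - $\mathrm{Id}$ (two parallel strands): $I(\mathrm{Id})=\mathrm{id}_{V\otimes V}$. - $\mathrm H$ (two solid ends merging at a trivalent vertex into a solid edge coloured $V^*$, which splits again into two solid ends): $I(\mathrm H)=r\,\pi_{V^*}$. - $\mathrm H_{do}$ (the same with a dotted middle edge): $I(\mathrm H_{do})=s\,\pi_U$. The factors $r,s\in\mathbf C[[\hat h]]$ depend on the freely chosen non-zero normalisation constants of the trivalent vertices and are non-zero. *)

theory Defs
  imports
    "HOL-Analysis.Analysis"
    "HOL-Computational_Algebra.Computational_Algebra"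
begin

(* Finite-dimensional complex vector spaces are coordinate spaces complex ^ 'n, endomorphisms are
   square matrices acting by *v.  Base change of End to C[[t]] and C((t)) is then the passage to
   matrices over "complex fps" and "complex fls", t = fps_X being the formal parameter. *)

abbreviation smult_mat :: "'a::times \<Rightarrow> 'a ^ 'm ^ 'n \<Rightarrow> 'a ^ 'm ^ 'n"  (infixr "*sm" 75)
  where "c *sm A \<equiv> map_matrix ((*) c) A"


text \<open>Lie algebras of type \<open>E\<^sub>6\<close>\<close>

type_synonym 'd bracket = "complex ^ 'd \<Rightarrow> complex ^ 'd \<Rightarrow> complex ^ 'd"

definition lie_algebra :: "'d::finite bracket \<Rightarrow> bool" where
  "lie_algebra br \<longleftrightarrow>
     (\<forall>x. Vector_Spaces.linear (*s) (*s) (br x)) \<and>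
     (\<forall>y. Vector_Spaces.linear (*s) (*s) (\<lambda>x. br x y)) \<and>
     (\<forall>x. br x x = 0) \<and>
     (\<forall>x y z. br x (br y z) + br y (br z x) + br z (br x y) = 0)"

definition lie_ideal :: "'d::finite bracket \<Rightarrow> (complex ^ 'd) set \<Rightarrow> bool" where
  "lie_ideal br J \<longleftrightarrow> vec.subspace J \<and> (\<forall>x. \<forall>y\<in>J. br x y \<in> J)"

definition lie_subalgebra :: "'d::finite bracket \<Rightarrow> (complex ^ 'd) set \<Rightarrow> bool" where
  "lie_subalgebra br S \<longleftrightarrow> vec.subspace S \<and> (\<forall>x\<in>S. \<forall>y\<in>S. br x y \<in> S)"

definition simple_lie_algebra :: "'d::finite bracket \<Rightarrow> bool" where
  "simple_lie_algebra br \<longleftrightarrow>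
     lie_algebra br \<and> (\<exists>x y. br x y \<noteq> 0) \<and> (\<forall>J. lie_ideal br J \<longrightarrow> J = {0} \<or> J = UNIV)"

definition killing :: "'d::finite bracket \<Rightarrow> complex ^ 'd \<Rightarrow> complex ^ 'd \<Rightarrow> complex" where
  "killing br x y = trace (matrix (\<lambda>z. br x (br y z)))"

(* Bourbaki numbering: the chain 1-3-4-5-6 with node 2 attached to node 4. *)
definition e6_cartan :: "nat \<Rightarrow> nat \<Rightarrow> int" where
  "e6_cartan i j =
     (if i = j then 2
      else if {i, j} \<in> {{1, 3}, {3, 4}, {4, 5}, {5, 6}, {2, 4}} then - 1
      else 0)"

(* The Lie algebra br is simple of type E6, with Chevalley generators E i, F i, H i (i = 1..6)
   satisfying the Chevalley-Serre relations. *)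
definition e6_lie_algebra ::
  "'d::finite bracket \<Rightarrow> (nat \<Rightarrow> complex ^ 'd) \<Rightarrow> (nat \<Rightarrow> complex ^ 'd) \<Rightarrow> (nat \<Rightarrow> complex ^ 'd) \<Rightarrow> bool"
where
  "e6_lie_algebra br E F H \<longleftrightarrow>
     simple_lie_algebra br \<and>
     (\<forall>i\<in>{1..6}. \<forall>j\<in>{1..6}.
        br (H i) (H j) = 0 \<and>
        br (E i) (F j) = (if i = j then H i else 0) \<and>
        br (H i) (E j) = of_int (e6_cartan i j) *s E j \<and>
        br (H i) (F j) = - of_int (e6_cartan i j) *s F j \<and>
        (i \<noteq> j \<longrightarrow>
           (br (E i) ^^ nat (1 - e6_cartan i j)) (E j) = 0 \<and>
           (br (F i) ^^ nat (1 - e6_cartan i j)) (F j) = 0)) \<and>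
     (\<forall>S. lie_subalgebra br S \<and> (\<forall>i\<in>{1..6}. E i \<in> S \<and> F i \<in> S \<and> H i \<in> S) \<longrightarrow> S = UNIV)"


text \<open>Representations\<close>

definition lie_representation :: "'d::finite bracket \<Rightarrow> (complex ^ 'd \<Rightarrow> complex ^ 'n ^ 'n::finite) \<Rightarrow> bool"
where
  "lie_representation br \<rho> \<longleftrightarrow>
     (\<forall>x y. \<rho> (x + y) = \<rho> x + \<rho> y) \<and>
     (\<forall>c x. \<rho> (c *s x) = c *sm \<rho> x) \<and>
     (\<forall>x y. \<rho> (br x y) = \<rho> x ** \<rho> y - \<rho> y ** \<rho> x)"

definition submodule :: "('g \<Rightarrow> complex ^ 'n ^ 'n::finite) \<Rightarrow> (complex ^ 'n) set \<Rightarrow> bool" where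
  "submodule \<rho> S \<longleftrightarrow> vec.subspace S \<and> (\<forall>x. \<forall>v\<in>S. \<rho> x *v v \<in> S)"

definition irreducible_submodule :: "('g \<Rightarrow> complex ^ 'n ^ 'n::finite) \<Rightarrow> (complex ^ 'n) set \<Rightarrow> bool"
where
  "irreducible_submodule \<rho> S \<longleftrightarrow>
     submodule \<rho> S \<and> S \<noteq> {0} \<and> (\<forall>R. submodule \<rho> R \<and> R \<subseteq> S \<longrightarrow> R = {0} \<or> R = S)"

(* A weight is the list of its six coordinates with respect to the fundamental weights, i.e. of
   its values on H 1, ..., H 6. *)
definition has_highest_weight ::
  "(nat \<Rightarrow> 'g) \<Rightarrow> (nat \<Rightarrow> 'g) \<Rightarrow> ('g \<Rightarrow> complex ^ 'n ^ 'n::finite) \<Rightarrow> (complex ^ 'n) set \<Rightarrow> nat list \<Rightarrow> bool"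
where
  "has_highest_weight E H \<rho> S w \<longleftrightarrow>
     (\<exists>v\<in>S. v \<noteq> 0 \<and> (\<forall>i\<in>{1..6}. \<rho> (E i) *v v = 0 \<and> \<rho> (H i) *v v = of_nat (w ! (i - 1)) *s v))"

definition irreducible_of_weight ::
  "(nat \<Rightarrow> 'g) \<Rightarrow> (nat \<Rightarrow> 'g) \<Rightarrow> ('g \<Rightarrow> complex ^ 'n ^ 'n::finite) \<Rightarrow> (complex ^ 'n) set \<Rightarrow> nat list \<Rightarrow> bool"
where
  "irreducible_of_weight E H \<rho> S w \<longleftrightarrow>
     irreducible_submodule \<rho> S \<and> has_highest_weight E H \<rho> S w"

definition dual_rep :: "('g \<Rightarrow> complex ^ 'n ^ 'n::finite) \<Rightarrow> 'g \<Rightarrow> complex ^ 'n ^ 'n" where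
  "dual_rep \<rho> x = - transpose (\<rho> x)"

definition isomorphic_to_submodule ::
  "('g \<Rightarrow> complex ^ 'm ^ 'm::finite) \<Rightarrow> ('g \<Rightarrow> complex ^ 'n ^ 'n::finite) \<Rightarrow> (complex ^ 'n) set \<Rightarrow> bool"
where
  "isomorphic_to_submodule \<sigma> \<rho> S \<longleftrightarrow>
     (\<exists>f. Vector_Spaces.linear (*s) (*s) f \<and> bij_betw f UNIV S \<and>
          (\<forall>x v. f (\<sigma> x *v v) = \<rho> x *v f v))"

(* The tensor product of complex ^ 'm and complex ^ 'n is complex ^ ('m * 'n), the pure tensor of
   v and w having the coordinates v $ i * w $ j. *)
definition kronecker :: "'a::times ^ 'm ^ 'm \<Rightarrow> 'a ^ 'n ^ 'n \<Rightarrow> 'a ^ ('m \<times> 'n) ^ ('m \<times> 'n)"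
  (infixr "\<otimes>\<^sub>k" 70)
where
  "A \<otimes>\<^sub>k B = (\<chi> p q. A $ fst p $ fst q * B $ snd p $ snd q)"

definition tensor_rep ::
  "('g \<Rightarrow> complex ^ 'm ^ 'm) \<Rightarrow> ('g \<Rightarrow> complex ^ 'n ^ 'n) \<Rightarrow> 'g \<Rightarrow> complex ^ ('m \<times> 'n) ^ ('m \<times> 'n)"
where
  "tensor_rep \<rho> \<sigma> x = \<rho> x \<otimes>\<^sub>k mat 1 + mat 1 \<otimes>\<^sub>k \<sigma> x"

definition flip :: "'a::zero_neq_one ^ ('n::finite \<times> 'n) ^ ('n \<times> 'n)" where
  "flip = (\<chi> p q. if p = prod.swap q then 1 else 0)"

definition internal_direct_sum3 ::
  "(complex ^ 'n) set \<Rightarrow> (complex ^ 'n) set \<Rightarrow> (complex ^ 'n) set \<Rightarrow> bool"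
where
  "internal_direct_sum3 A B C \<longleftrightarrow>
     (\<forall>v. \<exists>!(a, b, c). a \<in> A \<and> b \<in> B \<and> c \<in> C \<and> v = a + b + c)"

(* The projection onto Y along a complement Z. *)
definition projection :: "(complex ^ 'n) set \<Rightarrow> (complex ^ 'n) set \<Rightarrow> complex ^ 'n ^ 'n::finite" where
  "projection Y Z = (THE P. (\<forall>v\<in>Y. P *v v = v) \<and> (\<forall>v\<in>Z. P *v v = 0))"

definition subspace_sum :: "(complex ^ 'n) set \<Rightarrow> (complex ^ 'n) set \<Rightarrow> (complex ^ 'n) set" where
  "subspace_sum A B = {a + b | a b. a \<in> A \<and> b \<in> B}"


text \<open>The weight system on a chord and its exponential\<close>

(* Both families are indexed by 'd, hence have as many members as the dimension; the duality
   condition forces each of them to be a basis. *)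
definition dual_bases ::
  "'d::finite bracket \<Rightarrow> ('d \<Rightarrow> complex ^ 'd) \<Rightarrow> ('d \<Rightarrow> complex ^ 'd) \<Rightarrow> bool"
where
  "dual_bases br xs ys \<longleftrightarrow> (\<forall>a b. killing br (xs a) (ys b) = (if a = b then 1 else 0))"

definition Omega ::
  "(complex ^ 'd \<Rightarrow> complex ^ 'n ^ 'n) \<Rightarrow> ('d::finite \<Rightarrow> complex ^ 'd) \<Rightarrow> ('d \<Rightarrow> complex ^ 'd)
     \<Rightarrow> complex ^ ('n \<times> 'n) ^ ('n \<times> 'n)"
where
  "Omega \<rho> xs ys = (\<Sum>a\<in>UNIV. \<rho> (xs a) \<otimes>\<^sub>k \<rho> (ys a))"

definition Theta ::
  "complex \<Rightarrow> (complex ^ 'd \<Rightarrow> complex ^ 'n ^ 'n) \<Rightarrow> ('d::finite \<Rightarrow> complex ^ 'd) \<Rightarrow> ('d \<Rightarrow> complex ^ 'd)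
     \<Rightarrow> complex fps ^ ('n \<times> 'n) ^ ('n \<times> 'n)"
where
  "Theta h \<rho> xs ys = (fps_X ^ 2 * fps_const (1 / h)) *sm map_matrix fps_const (Omega \<rho> xs ys)"

primrec mat_power :: "'a::semiring_1 ^ 'n ^ 'n::finite \<Rightarrow> nat \<Rightarrow> 'a ^ 'n ^ 'n" where
  "mat_power A 0 = mat 1"
| "mat_power A (Suc k) = A ** mat_power A k"

(* The sum is taken in the adic topology of "complex fps"; it converges as soon as the entries of A
   have zero constant term. *)
definition mat_exp :: "complex fps ^ 'n ^ 'n::finite \<Rightarrow> complex fps ^ 'n ^ 'n" where
  "mat_exp A = (\<Sum>k. fps_const (1 / fact k) *sm mat_power A k)"

(* The formal power series exp (- t^2 / (72 h)). *)
definition q_series :: "complex \<Rightarrow> complex fps" where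
  "q_series h = fps_exp (- 1 / (72 * h)) oo fps_X ^ 2"

end

theory Submission
  imports Defs
begin

text \<open>
  The tensor square has three irreducible summands, on each of which the flip acts by a sign and
  \<open>\<Omega>\<close> by a scalar. No root system is needed to find them. Highest weight vectors, located with a
  grading element that takes the value 2 on the simple roots, show that the flip is \<open>1\<close> on \<open>U\<close> and
  \<open>-1\<close> on \<open>W\<close>. If \<open>C\<close> is the Casimir eigenvalue on \<open>V\<close>, then it is also the one on the dual, so
  \<open>\<Omega>\<close> is \<open>-C/2\<close> on that summand. As \<open>\<Omega>\<close> has trace 0 and flip \<open>\<Omega>\<close> has trace \<open>27 C\<close>, the other two
  scalars are \<open>C/13\<close> and \<open>-C/26\<close>. Finally the Casimir element of the Killing form is the identity on the
  adjoint representation, hence flip \<open>\<Omega>\<^sup>2\<close> has trace \<open>27 C (C - 1/2)\<close>, which gives \<open>C = 13/18\<close>.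
\<close>

text \<open>The obstacle is to get numbers without weight multiplicities: the dimensions of U and W,
  the scalars of \<open>Omega\<close> on the summands and the sign of the flip on the dual summand
  are all unknown at first. The traces of 1, flip, \<open>Omega\<close> and flip
  \<open>Omega\<close> are homogeneous in the scalars of \<open>Omega\<close> and fix them only up
  to a common factor. The trace of flip \<open>Omega\<close>^2 sees the normalisation of the Killing
  form: moving an element through the Casimir sum costs half of the adjoint Casimir eigenvalue,
  whence the 1/2 next to C. The exponents come from multiplying 1/18, -13/36, -1/36 by -1/(2h),
  which gives -2, 13, 1 in units of 1/(72h). With the signs of the flip, the crossing is q^2 on U,
  q^-13 on the dual and -q^-1 on W. Writing the projection onto W as the identity minus the other
  two gives the coefficient -q^-1 of the identity and adds q^-1 to the other two
  coefficients.\<close>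

unbundle no Formal_Power_Series.fps_syntax

subsection \<open>Matrices and tensor products\<close>

lemma smult_mat_mult_left: "(c *sm A) ** B = (c::'a::comm_semiring_1) *sm (A ** B)"
  by (simp add: vec_eq_iff matrix_matrix_mult_def sum_distrib_left ac_simps)

lemma smult_mat_mult_right: "A ** (c *sm B) = (c::'a::comm_semiring_1) *sm (A ** B)"
  by (simp add: vec_eq_iff matrix_matrix_mult_def sum_distrib_left ac_simps)

lemma smult_mat_mult_vec: "(c *sm A) *v x = (c::'a::comm_semiring_1) *s (A *v x)"
  by (simp add: vec_eq_iff matrix_vector_mult_def sum_distrib_left ac_simps)

lemma matrix_add_rdistrib_mult: "(A + B) ** C = A ** C + B ** (C::'a::semiring_1^_^_)"
  by (simp add: vec_eq_iff matrix_matrix_mult_def sum.distrib algebra_simps)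

lemma matrix_mult_diff_left: "(A - B) ** C = A ** C - B ** (C::'a::ring_1^_^_)"
  by (simp add: vec_eq_iff matrix_matrix_mult_def sum_subtractf algebra_simps)

lemma matrix_mult_diff_right: "A ** (B - C) = A ** B - A ** (C::'a::ring_1^_^_)"
  by (simp add: vec_eq_iff matrix_matrix_mult_def sum_subtractf algebra_simps)

lemma matrix_mult_sum_left: "(\<Sum>i\<in>S. A i) ** B = (\<Sum>i\<in>S. A i ** (B::'a::semiring_1^_^_))"
  by (induction S rule: infinite_finite_induct) (simp_all add: matrix_add_rdistrib_mult)

lemma matrix_mult_sum_right: "B ** (\<Sum>i\<in>S. A i) = (\<Sum>i\<in>S. B ** (A i::'a::semiring_1^_^_))"
  by (induction S rule: infinite_finite_induct) (simp_all add: matrix_add_ldistrib)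

lemma matrix_vector_mult_sum_left: "(\<Sum>i\<in>S. A i) *v x = (\<Sum>i\<in>S. A i *v (x::'a::semiring_1^_))"
  by (induction S rule: infinite_finite_induct) (simp_all add: matrix_vector_mult_add_rdistrib)

lemma trace_sum: "trace (\<Sum>i\<in>S. A i) = (\<Sum>i\<in>S. trace (A i :: 'a::comm_semiring_1^'n^'n))"
  by (induction S rule: infinite_finite_induct) (simp_all add: trace_def sum.distrib)

lemma trace_smult_mat: "trace (c *sm A) = (c::'a::comm_semiring_1) * trace A"
  by (simp add: trace_def sum_distrib_left)

lemma sum_prod_UNIV: "(\<Sum>p\<in>(UNIV::('a::finite \<times> 'b::finite) set). f p) = (\<Sum>i\<in>UNIV. \<Sum>j\<in>UNIV. f (i, j))"
  by (simp add: sum.cartesian_product)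

lemma kronecker_mult:
  "(A \<otimes>\<^sub>k B) ** (C \<otimes>\<^sub>k D) = (A ** C) \<otimes>\<^sub>k (B ** (D::'a::comm_semiring_1^_^_))"
  by (simp add: vec_eq_iff matrix_matrix_mult_def kronecker_def sum_prod_UNIV sum_product ac_simps)

lemma trace_kronecker: "trace (A \<otimes>\<^sub>k B) = trace A * trace (B::'a::comm_semiring_1^_^_)"
  by (simp add: trace_def kronecker_def sum_prod_UNIV sum_product)

lemma flip_mult_nth: "(flip ** A) $ p $ q = (A :: 'a::semiring_1^_^_) $ prod.swap p $ q"
proof -
  have "(if p = prod.swap k then 1 else 0) * A $ k $ q = (if k = prod.swap p then A $ k $ q else 0)" for k
    by auto
  then show ?thesis
    by (simp add: flip_def matrix_matrix_mult_def)
qed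

lemma mult_flip_nth: "(A ** flip) $ p $ q = (A :: 'a::semiring_1^_^_) $ p $ prod.swap q"
proof -
  have "A $ p $ k * (if k = prod.swap q then 1 else 0) = (if k = prod.swap q then A $ p $ k else 0)" for k
    by auto
  then show ?thesis
    by (simp add: flip_def matrix_matrix_mult_def)
qed

lemma flip_kronecker: "flip ** (A \<otimes>\<^sub>k B) = (B \<otimes>\<^sub>k A) ** (flip::'a::comm_semiring_1^_^_)"
  by (auto simp: vec_eq_iff flip_mult_nth mult_flip_nth kronecker_def mult.commute)

lemma flip_flip: "flip ** flip = (mat 1 :: 'a::semiring_1^_^_)"
  by (simp add: vec_eq_iff flip_mult_nth) (auto simp: flip_def mat_def)

text \<open>The flip joins the two tensor factors into a single cycle, so a trace over the tensor
  square becomes one over V. This is how Casimir sums arise from traces of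
  \<open>Omega\<close>.\<close>

lemma trace_flip_kronecker:
  "trace (flip ** (A \<otimes>\<^sub>k B)) = trace (A ** (B::'a::comm_semiring_1^_^_))"
  unfolding trace_def flip_mult_nth
  by (simp add: kronecker_def sum_prod_UNIV matrix_matrix_mult_def) (rule sum.swap)

lemma trace_flip: "trace (flip :: complex ^ ('n::finite \<times> 'n) ^ ('n \<times> 'n)) = of_nat CARD('n)"
proof -
  have "mat 1 \<otimes>\<^sub>k mat 1 = (mat 1 :: complex ^ ('n \<times> 'n) ^ ('n \<times> 'n))"
    by (auto simp: vec_eq_iff kronecker_def mat_def)
  then show ?thesis
    using trace_flip_kronecker[of "mat 1 :: complex ^ 'n ^ 'n" "mat 1"]
    by (simp add: trace_I)
qed

definition pure :: "complex ^ 'm \<Rightarrow> complex ^ 'n \<Rightarrow> complex ^ ('m \<times> 'n)" where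
  "pure v w = (\<chi> p. v $ fst p * w $ snd p)"

lemma kronecker_pure: "(A \<otimes>\<^sub>k B) *v pure v w = pure (A *v v) (B *v w)"
  by (simp add: vec_eq_iff matrix_vector_mult_def kronecker_def pure_def sum_prod_UNIV sum_product ac_simps)

lemma flip_pure: "flip *v pure v w = pure w v"
proof -
  have "(if p = prod.swap k then 1 else 0) * pure v w $ k = (if k = prod.swap p then pure v w $ k else 0)"
    for k p by auto
  then have "(flip *v pure v w) $ p = pure v w $ prod.swap p" for p
    by (simp add: flip_def matrix_vector_mult_def)
  then show ?thesis
    by (simp add: vec_eq_iff pure_def)
qed

lemma pure_simps:
  "pure (v + v') w = pure v w + pure v' w" "pure v (w + w') = pure v w + pure v w'"
  "pure (c *s v) w = c *s pure v w" "pure v (c *s w) = c *s pure v w"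
  "pure 0 w = 0" "pure v 0 = 0"
  by (simp_all add: vec_eq_iff pure_def algebra_simps)

lemma pure_eq_0_iff: "pure v w = 0 \<longleftrightarrow> v = 0 \<or> w = 0"
  by (auto simp: vec_eq_iff pure_def)

lemma tensor_rep_pure: "tensor_rep \<rho> \<sigma> x *v pure v w = pure (\<rho> x *v v) w + pure v (\<sigma> x *v w)"
  by (simp add: tensor_rep_def matrix_vector_mult_add_rdistrib kronecker_pure)

text \<open>Transports a spanning set of eigenvectors from V to the tensor square.\<close>

lemma span_pure:
  assumes "vec.span S = UNIV"
  shows "vec.span {pure s t | s t. s \<in> S \<and> t \<in> S} = (UNIV :: (complex ^ ('n \<times> 'n::finite)) set)"
proof -
  let ?T = "{pure s t | s t. s \<in> S \<and> t \<in> S}"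
  have 1: "pure v t \<in> vec.span ?T" if "t \<in> S" for v t
  proof -
    have "v \<in> vec.span S" using assms by simp
    then show ?thesis
      by (induction rule: vec.span_induct_alt)
         (use that in \<open>auto simp: pure_simps vec.span_zero intro!: vec.span_add vec.span_scale intro: vec.span_base\<close>)
  qed
  have 2: "pure v w \<in> vec.span ?T" for v w
  proof -
    have "w \<in> vec.span S" using assms by simp
    then show ?thesis
      by (induction rule: vec.span_induct_alt)
         (use 1 in \<open>auto simp: pure_simps intro!: vec.span_add vec.span_scale vec.span_zero\<close>)
  qed
  have "x \<in> vec.span ?T" for x :: "complex ^ ('n \<times> 'n)"
  proof -
    have "axis (i, j) 1 = pure (axis i 1) (axis j 1)" for i j :: 'n
      by (auto simp: vec_eq_iff pure_def axis_def)
    then have "axis p 1 \<in> vec.span ?T" for p using 2 by (cases p) auto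
    then show ?thesis
      by (subst basis_expansion[of x, symmetric]) (auto intro!: vec.span_sum vec.span_scale)
  qed
  then show ?thesis by blast
qed

subsection \<open>Eigenvectors\<close>

text \<open>Expand \<open>x\<close> in a basis chosen inside \<open>S\<close> and compare the
  coefficients of \<open>T *v x\<close> and \<open>c *s x\<close>: only basis vectors with
  eigenvalue \<open>c\<close> survive. An eigenspace can thus be read off from any spanning list of
  eigenvectors, which replaces a weight space decomposition.\<close>

lemma eigenvector_in_span_eigenvectors:
  fixes T :: "complex ^ 'm ^ 'm"
  assumes span: "vec.span S = UNIV"
    and eig: "\<And>s. s \<in> S \<Longrightarrow> \<exists>c. T *v s = c *s s"
    and x: "T *v x = c *s x"
  shows "x \<in> vec.span {s \<in> S. T *v s = c *s s}"
proof -
  obtain B where B: "B \<subseteq> S" "vec.independent B" "S \<subseteq> vec.span B"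
    using vec.maximal_independent_subset[of S] by blast
  have spanB: "vec.span B = UNIV"
    using B(3) span vec.span_mono[OF B(3)] by (auto simp: vec.span_span)
  have fin: "finite B" by (rule vec.finiteI_independent[OF B(2)])
  obtain e where e: "\<And>s. s \<in> S \<Longrightarrow> T *v s = e s *s s" using eig by metis
  obtain a where a: "x = (\<Sum>b\<in>B. a b *s b)"
    using spanB vec.span_finite[OF fin] by blast
  have "T *v x = (\<Sum>b\<in>B. (a b * e b) *s b)"
    unfolding a using B(1) e by (auto simp: vec.sum vec.scale vector_smult_assoc intro!: sum.cong)
  moreover have "c *s x = (\<Sum>b\<in>B. (c * a b) *s b)"
    unfolding a by (simp add: vec.scale_sum_right vector_smult_assoc)
  ultimately have "(\<Sum>b\<in>B. (a b * e b - c * a b) *s b) = 0"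
    using x by (simp add: vector_sub_rdistrib sum_subtractf)
  then have z: "a b * e b - c * a b = 0" if "b \<in> B" for b
    by (rule vec.independentD[OF B(2) fin subset_refl _ that])
  have "a b *s b \<in> vec.span {s \<in> S. T *v s = c *s s}" if b: "b \<in> B" for b
  proof (cases "a b = 0")
    case False
    then have "e b = c" using z[OF b] by (simp add: algebra_simps)
    then show ?thesis using b B(1) e by (intro vec.span_scale vec.span_base) auto
  qed (simp add: vec.span_zero)
  then show ?thesis unfolding a by (intro vec.span_sum)
qed

text \<open>The sum is p(T) x. Split off a root z of p: either x is an eigenvector for z, or T x - z
  x is a nonzero vector annihilated by the cofactor, which has smaller degree.\<close>

lemma exists_eigenvector_aux:
  fixes T :: "complex ^ 'm ^ 'm"
  assumes "p \<noteq> 0" "x \<noteq> 0" "(\<Sum>i\<le>degree p. coeff p i *s (((*v) T) ^^ i) x) = 0"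
  shows "\<exists>c y. y \<noteq> 0 \<and> T *v y = c *s y"
  using assms
proof (induction "degree p" arbitrary: p x)
  case 0
  then have "degree p = 0" "coeff p 0 \<noteq> 0" by (auto simp: leading_coeff_0_iff[symmetric] simp del: leading_coeff_0_iff)
  then show ?case using 0 by simp
next
  case (Suc n)
  define P where "P p x = (\<Sum>i\<le>degree p. coeff p i *s (((*v) T) ^^ i) x)" for p x
  have P: "P p x = (\<Sum>i\<le>m. coeff p i *s (((*v) T) ^^ i) x)" if "degree p \<le> m" for p x m
    unfolding P_def using that by (intro sum.mono_neutral_left) (auto simp: coeff_eq_0)
  obtain z where "poly p z = 0"
    using alg_closed_imp_poly_has_root[of p] Suc.hyps(2) by (metis zero_less_Suc)
  then obtain r where r: "p = [:- z, 1:] * r" by (auto simp: poly_eq_0_iff_dvd elim: dvdE)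
  have r0: "r \<noteq> 0" using r Suc.prems(1) by auto
  have "degree p = Suc (degree r)" using r r0 by (simp add: degree_mult_eq del: mult_pCons_left)
  then have n: "n = degree r" using Suc.hyps(2) by simp
  let ?y = "T *v x - z *s x"
  have pw: "(((*v) T) ^^ i) ?y = (((*v) T) ^^ Suc i) x - z *s (((*v) T) ^^ i) x" for i
    by (induction i) (simp_all add: matrix_vector_mult_diff_distrib vec.scale)
  have cp: "coeff p i = - z * coeff r i + (case i of 0 \<Rightarrow> 0 | Suc j \<Rightarrow> coeff r j)" for i
    unfolding r by (simp add: coeff_pCons split: nat.split)
  let ?f = "\<lambda>i. (((*v) T) ^^ i) x"
  have "P p x = (\<Sum>i\<le>Suc n. coeff p i *s ?f i)"
    by (rule P) (use Suc.hyps in simp)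
  also have "\<dots> = (\<Sum>i\<le>Suc n. (- z * coeff r i) *s ?f i)
      + (\<Sum>i\<le>Suc n. (case i of 0 \<Rightarrow> 0 | Suc j \<Rightarrow> coeff r j) *s ?f i)"
    unfolding cp by (simp only: vector_sadd_rdistrib sum.distrib)
  also have "(\<Sum>i\<le>Suc n. (- z * coeff r i) *s ?f i) = (\<Sum>i\<le>n. (- z * coeff r i) *s ?f i)"
    using n by (simp add: coeff_eq_0)
  also have "(\<Sum>i\<le>Suc n. (case i of 0 \<Rightarrow> 0 | Suc j \<Rightarrow> coeff r j) *s ?f i) = (\<Sum>i\<le>n. coeff r i *s ?f (Suc i))"
    by (subst sum.atMost_Suc_shift) simp
  also have "(\<Sum>i\<le>n. (- z * coeff r i) *s ?f i) + (\<Sum>i\<le>n. coeff r i *s ?f (Suc i))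
     = (\<Sum>i\<le>n. coeff r i *s (?f (Suc i) - z *s ?f i))"
    by (simp add: sum.distrib[symmetric] vector_ssub_ldistrib vector_smult_assoc mult.commute del: funpow.simps)

  also have "\<dots> = P r ?y" unfolding P_def n pw ..
  finally have "P r ?y = 0" using Suc.prems(3) unfolding P_def by simp
  show ?case
  proof (cases "?y = 0")
    case True
    then show ?thesis using Suc.prems(2) by (metis right_minus_eq)
  next
    case False
    show ?thesis by (rule Suc.hyps(1)[OF n r0 False]) (use \<open>P r ?y = 0\<close> in \<open>simp add: P_def\<close>)
  qed
qed

text \<open>One more iterate of a nonzero vector than the dimension must satisfy a linear relation,
  whose coefficients form an annihilating polynomial.\<close>

lemma exists_eigenvector:
  fixes T :: "complex ^ 'm ^ 'm"
  shows "\<exists>c y. y \<noteq> 0 \<and> T *v y = c *s y"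
proof -
  obtain x :: "complex ^ 'm" where x: "x \<noteq> 0"
    by (metis axis_eq_0_iff zero_neq_one)
  define f where "f i = (((*v) T) ^^ i) x" for i
  have "\<exists>a::nat\<Rightarrow>complex. (\<exists>i\<le>CARD('m). a i \<noteq> 0) \<and> (\<Sum>i\<le>CARD('m). a i *s f i) = 0"
  \<comment> \<open>Dependence is a property of sets, so a repetition among the iterates needs its
    own relation, the difference of two equal terms.\<close>
  proof (cases "inj_on f {..CARD('m)}")
    case True
    then have c: "card (f ` {..CARD('m)}) = Suc CARD('m)" by (simp add: card_image)
    have "vec.dependent (f ` {..CARD('m)})"
    proof (rule ccontr)
      assume "\<not> vec.dependent (f ` {..CARD('m)})"
      then have "card (f ` {..CARD('m)}) \<le> vec.dim (UNIV :: (complex ^ 'm) set)"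
        using vec.independent_card_le_dim[of _ "UNIV :: (complex ^ 'm) set"] by blast
      then show False using c by (simp add: card_cart_basis vec.dim_UNIV)
    qed
    then obtain u v where u: "(\<Sum>v\<in>f ` {..CARD('m)}. u v *s v) = 0" "v \<in> f ` {..CARD('m)}" "u v \<noteq> 0"
      using vec.dependent_finite[of "f ` {..CARD('m)}"] by auto
    then show ?thesis using True
      by (intro exI[of _ "\<lambda>i. u (f i)"]) (auto simp: sum.reindex)
  next
    case False
    then obtain i j where ij: "i \<le> CARD('m)" "j \<le> CARD('m)" "i \<noteq> j" "f i = f j"
      by (auto simp: inj_on_def)
    let ?a = "\<lambda>k. if k = i then 1 else if k = j then -1 else 0 :: complex"
    have "(\<Sum>k\<le>CARD('m). ?a k *s f k) = (\<Sum>k\<in>{i,j}. ?a k *s f k)"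
      by (rule sum.mono_neutral_right) (use ij in auto)
    also have "\<dots> = 0" using ij by simp
    finally show ?thesis using ij by (intro exI[of _ ?a]) auto
  qed
  then obtain a where a: "\<exists>i\<le>CARD('m). a i \<noteq> 0" "(\<Sum>i\<le>CARD('m). a i *s f i) = 0" by blast
  define p where "p = (\<Sum>i\<le>CARD('m). monom (a i) i)"
  have cp: "coeff p i = (if i \<le> CARD('m) then a i else 0)" for i
    unfolding p_def by (simp add: coeff_sum)
  have "p \<noteq> 0" using a(1) cp by (metis coeff_0)
  moreover have "degree p \<le> CARD('m)" by (rule degree_le) (simp add: cp)
  then have "(\<Sum>i\<le>degree p. coeff p i *s f i) = (\<Sum>i\<le>CARD('m). coeff p i *s f i)"
    by (intro sum.mono_neutral_left) (auto simp: coeff_eq_0)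
  then have "(\<Sum>i\<le>degree p. coeff p i *s f i) = 0" using a(2) by (simp add: cp)
  ultimately show ?thesis using exists_eigenvector_aux[of p x T] x unfolding f_def by blast
qed

subsection \<open>Representations and the Killing form\<close>

lemma lie_representationD:
  assumes "lie_representation br \<sigma>"
  shows "\<sigma> (x + y) = \<sigma> x + \<sigma> y" "\<sigma> (c *s x) = c *sm \<sigma> x"
    "\<sigma> (br x y) = \<sigma> x ** \<sigma> y - \<sigma> y ** \<sigma> x" "\<sigma> 0 = 0" "\<sigma> (- x) = - \<sigma> x"
    "\<sigma> (x - y) = \<sigma> x - \<sigma> y" "\<sigma> (\<Sum>i\<in>A. g i) = (\<Sum>i\<in>A. \<sigma> (g i))"
proof -
  show add: "\<sigma> (x + y) = \<sigma> x + \<sigma> y" and sc: "\<sigma> (c *s x) = c *sm \<sigma> x"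
    and "\<sigma> (br x y) = \<sigma> x ** \<sigma> y - \<sigma> y ** \<sigma> x" for x y c
    using assms by (simp_all add: lie_representation_def)
  show z: "\<sigma> 0 = 0" using sc[of 0 0] by (simp add: vec_eq_iff)
  show m: "\<sigma> (- x) = - \<sigma> x" for x
    unfolding vector_sneg_minus1[of x] sc by (simp add: vec_eq_iff)
  show "\<sigma> (x - y) = \<sigma> x - \<sigma> y" using add[of x "- y"] m by simp
  show "\<sigma> (\<Sum>i\<in>A. g i) = (\<Sum>i\<in>A. \<sigma> (g i))"
    by (induction A rule: infinite_finite_induct) (simp_all add: z add)
qed

lemma smult_mat_0: "c *sm 0 = (0 :: 'a::mult_zero ^ _ ^ _)"
  by (simp add: vec_eq_iff)

lemma kronecker_diff:
  "(A - B) \<otimes>\<^sub>k C = A \<otimes>\<^sub>k C - B \<otimes>\<^sub>k (C :: 'a::comm_ring_1 ^ _ ^ _)"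
  "C \<otimes>\<^sub>k (A - B) = C \<otimes>\<^sub>k A - C \<otimes>\<^sub>k (B :: 'a::comm_ring_1 ^ _ ^ _)"
  by (simp_all add: vec_eq_iff kronecker_def algebra_simps)

lemma lie_representation_tensor_rep:
  assumes "lie_representation br \<rho>" "lie_representation br \<sigma>"
  shows "lie_representation br (tensor_rep \<rho> \<sigma>)"
proof -
  have 1: "tensor_rep \<rho> \<sigma> (x + y) = tensor_rep \<rho> \<sigma> x + tensor_rep \<rho> \<sigma> y" for x y
    by (simp add: tensor_rep_def lie_representationD[OF assms(1)] lie_representationD[OF assms(2)]
        vec_eq_iff kronecker_def algebra_simps)
  have 2: "tensor_rep \<rho> \<sigma> (c *s x) = c *sm tensor_rep \<rho> \<sigma> x" for c x
    by (simp add: tensor_rep_def lie_representationD[OF assms(1)] lie_representationD[OF assms(2)]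
        vec_eq_iff kronecker_def algebra_simps)
  have 3: "tensor_rep \<rho> \<sigma> (br x y) = tensor_rep \<rho> \<sigma> x ** tensor_rep \<rho> \<sigma> y - tensor_rep \<rho> \<sigma> y ** tensor_rep \<rho> \<sigma> x"
    for x y
  proof -
    show ?thesis
      by (simp add: kronecker_diff tensor_rep_def lie_representationD[OF assms(1)] lie_representationD[OF assms(2)]
         matrix_add_ldistrib matrix_add_rdistrib_mult kronecker_mult)
  qed
  show ?thesis unfolding lie_representation_def using 1 2 3 by blast
qed

text \<open>Sums over dual bases are matrix valued below; they are treated entrywise through scalar
  forms, so that the facts on dual bases are proved once for all such sums.\<close>

definition bilinear_form :: "(complex ^ 'd \<Rightarrow> complex ^ 'd \<Rightarrow> complex) \<Rightarrow> bool" where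
  "bilinear_form G \<longleftrightarrow>
     (\<forall>x x' y. G (x + x') y = G x y + G x' y) \<and> (\<forall>c x y. G (c *s x) y = c * G x y) \<and>
     (\<forall>x y y'. G x (y + y') = G x y + G x y') \<and> (\<forall>c x y. G x (c *s y) = c * G x y)"

lemma bilinear_form_sum:
  assumes "bilinear_form G"
  shows "G (\<Sum>a\<in>A. f a *s v a) y = (\<Sum>a\<in>A. f a * G (v a) y)"
    and "G x (\<Sum>a\<in>A. f a *s v a) = (\<Sum>a\<in>A. f a * G x (v a))"
proof -
  have "G 0 y = 0" "G x 0 = 0"
    using assms unfolding bilinear_form_def by (metis mult_zero_left vector_smult_lzero)+
  then show "G (\<Sum>a\<in>A. f a *s v a) y = (\<Sum>a\<in>A. f a * G (v a) y)"
    and "G x (\<Sum>a\<in>A. f a *s v a) = (\<Sum>a\<in>A. f a * G x (v a))"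
    using assms unfolding bilinear_form_def
    by (induction A rule: infinite_finite_induct) simp_all
qed

lemma bilinear_form_rep_mult:
  assumes "lie_representation br \<sigma>"
  shows "bilinear_form (\<lambda>x y. (\<sigma> x ** M ** \<sigma> y) $ i $ j)"
  unfolding bilinear_form_def
  by (simp add: lie_representationD[OF assms] smult_mat_mult_left smult_mat_mult_right
      matrix_add_rdistrib_mult matrix_add_ldistrib)

lemma bilinear_form_rep_kronecker:
  assumes "lie_representation br \<rho>"
  shows "bilinear_form (\<lambda>x y. (\<rho> x \<otimes>\<^sub>k \<rho> y) $ p $ q)"
  unfolding bilinear_form_def kronecker_def
  by (simp add: lie_representationD[OF assms] algebra_simps)

lemma lie_algebraD:
  assumes "lie_algebra br"
  shows "br x (y + z) = br x y + br x z" "br (x + y) z = br x z + br y z"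
    "br x (c *s y) = c *s br x y" "br (c *s x) y = c *s br x y"
    "br x x = 0"
    "br x 0 = 0" "br 0 x = 0"
    "br x (- y) = - br x y" "br x (\<Sum>i\<in>A. g i) = (\<Sum>i\<in>A. br x (g i))"
    "br (\<Sum>i\<in>A. g i) x = (\<Sum>i\<in>A. br (g i) x)"
proof -
  have l: "Vector_Spaces.linear (*s) (*s) (br x)" "Vector_Spaces.linear (*s) (*s) (\<lambda>x. br x y)" for x y
    using assms by (auto simp: lie_algebra_def)
  show "br x (y + z) = br x y + br x z" "br x (c *s y) = c *s br x y" "br x (- y) = - br x y" "br x 0 = 0"
    "br x (\<Sum>i\<in>A. g i) = (\<Sum>i\<in>A. br x (g i))"
    using vec.linear_add[OF l(1)] vec.linear_scale[OF l(1)] vec.linear_neg[OF l(1)] vec.linear_0[OF l(1)]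
     vec.linear_sum[OF l(1)]
    by auto
  show "br (x + y) z = br x z + br y z" "br (c *s x) y = c *s br x y" "br 0 x = 0"
    "br (\<Sum>i\<in>A. g i) x = (\<Sum>i\<in>A. br (g i) x)"
    using vec.linear_add[OF l(2)] vec.linear_scale[OF l(2)] vec.linear_0[OF l(2)] vec.linear_sum[OF l(2)] by auto
  show "br x x = 0" using assms by (auto simp: lie_algebra_def)
qed

lemma lie_bracket_antisym:
  assumes "lie_algebra br"
  shows "br x y = - br y x"
proof -
  have "0 = br (x + y) (x + y)" by (rule lie_algebraD(5)[OF assms, symmetric])
  also have "\<dots> = br x x + br x y + (br y x + br y y)"
    by (simp only: lie_algebraD(1,2)[OF assms]) (simp add: add_ac)
  finally have "br x y + br y x = 0" by (simp add: lie_algebraD(5)[OF assms])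
  then show ?thesis by (simp add: eq_neg_iff_add_eq_0)
qed

abbreviation "adj br x \<equiv> matrix (br x)"

lemma adj_mult_vec: "lie_algebra br \<Longrightarrow> adj br x *v y = br x y"
  by (rule matrix_works) (simp add: lie_algebra_def)

lemma lie_representation_adj:
  assumes "lie_algebra br"
  shows "lie_representation br (adj br)"
  unfolding lie_representation_def
proof (intro conjI allI)
  note d = lie_algebraD[OF assms] adj_mult_vec[OF assms]
  show "adj br (x + y) = adj br x + adj br y" for x y
    by (simp add: matrix_eq matrix_vector_mult_add_rdistrib d)
  show "adj br (c *s x) = c *sm adj br x" for c x
    by (simp add: matrix_eq smult_mat_mult_vec d)
  show "adj br (br x y) = adj br x ** adj br y - adj br y ** adj br x" for x y
  proof -
    have "br (br x y) z = br x (br y z) - br y (br x z)" for z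
    proof -
      have "br x (br y z) + br y (br z x) + br z (br x y) = 0"
        using assms by (auto simp: lie_algebra_def)
      moreover have "br (br x y) z = - br z (br x y)" "br z x = - br x z"
        by (rule lie_bracket_antisym[OF assms])+
      ultimately show ?thesis by (simp add: d algebra_simps add_eq_0_iff)
    qed
    then show ?thesis
      by (simp add: matrix_eq matrix_vector_mult_diff_rdistrib matrix_vector_mul_assoc[symmetric] d)
  qed
qed

lemma killing_eq_trace:
  assumes "lie_algebra br"
  shows "killing br x y = trace (adj br x ** adj br y)"
proof -
  have "adj br x ** adj br y = matrix (br x \<circ> br y)"
    using assms by (intro matrix_compose_gen[symmetric]) (auto simp: lie_algebra_def)
  then show ?thesis by (simp add: killing_def comp_def)
qed

lemma trace_form_invariant:
  assumes "lie_representation br \<sigma>"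
  shows "trace (\<sigma> (br x y) ** \<sigma> z) = trace (\<sigma> x ** \<sigma> (br y z))"
proof -
  have "trace (\<sigma> y ** \<sigma> x ** \<sigma> z) = trace (\<sigma> x ** (\<sigma> z ** \<sigma> y))"
    using trace_mul_sym[of "\<sigma> y" "\<sigma> x ** \<sigma> z"] by (simp add: matrix_mul_assoc)
  then show ?thesis
    by (simp add: lie_representationD[OF assms] matrix_mult_diff_left matrix_mult_diff_right trace_sub matrix_mul_assoc)
qed

lemma bilinear_form_trace:
  assumes "lie_representation br \<sigma>"
  shows "bilinear_form (\<lambda>x y. trace (\<sigma> x ** \<sigma> y))"
  unfolding bilinear_form_def
  by (simp add: lie_representationD[OF assms] smult_mat_mult_left smult_mat_mult_right
      matrix_add_rdistrib_mult matrix_add_ldistrib trace_add trace_smult_mat)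

lemma
  assumes "lie_algebra br"
  shows bilinear_form_killing: "bilinear_form (killing br)"
    and killing_sym: "killing br x y = killing br y x"
    and killing_invariant: "killing br (br x y) z = killing br x (br y z)"
proof -
  have e: "killing br = (\<lambda>x y. trace (adj br x ** adj br y))"
    by (intro ext killing_eq_trace assms)
  note r = lie_representation_adj[OF assms]
  show "bilinear_form (killing br)" unfolding e by (rule bilinear_form_trace[OF r])
  show "killing br x y = killing br y x" unfolding e by (rule trace_mul_sym)
  show "killing br (br x y) z = killing br x (br y z)" unfolding e by (rule trace_form_invariant[OF r])
qed

text \<open>Duality makes the coordinate map \<open>T\<close> surjective; source and target have the
  same dimension, so it is injective, and both sides have the same coordinates. Nondegeneracy of the
  Killing form is a consequence of this.\<close>

lemma dual_bases_expansion:
  assumes lie: "lie_algebra br" and dual: "dual_bases br xs ys"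
  shows "z = (\<Sum>a\<in>UNIV. killing br (xs a) z *s ys a)"
proof -
  note bf = bilinear_form_killing[OF lie]
  define T where "T z = (\<chi> a. killing br (xs a) z)" for z
  have lin: "Vector_Spaces.linear (*s) (*s) T"
    using bf by (intro Vector_Spaces.linear_iff[THEN iffD2])
      (auto simp: T_def bilinear_form_def vec_eq_iff vec.vector_space_axioms)
  have Te: "T (\<Sum>a\<in>UNIV. w $ a *s ys a) = w" for w
    using dual by (simp add: T_def vec_eq_iff bilinear_form_sum[OF bf] dual_bases_def
        if_distrib[where f = "(*) _"] cong: if_cong)
  then have "surj T" by (rule surjI)
  then have "inj T" using vec.linear_surj_imp_inj[OF lin] by blast
  moreover have "T (\<Sum>a\<in>UNIV. killing br (xs a) z *s ys a) = T z"
    using Te[of "T z"] by (simp add: T_def)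
  ultimately show ?thesis by (rule injD[THEN sym])
qed

section \<open>Sums over dual bases of the Killing form\<close>

locale killing_dual_bases =
  fixes br :: "'d::finite bracket" and xs ys :: "'d \<Rightarrow> complex ^ 'd"
  assumes lie: "lie_algebra br" and dual: "dual_bases br xs ys"
begin

lemma swapped: "killing_dual_bases br ys xs"
  using lie dual killing_sym[OF lie]
  by (auto simp: killing_dual_bases_def dual_bases_def)

lemmas expand_ys = dual_bases_expansion[OF lie dual]

lemma expand_xs: "z = (\<Sum>a\<in>UNIV. killing br z (ys a) *s xs a)"
  using killing_dual_bases.expand_ys[OF swapped, of z] killing_sym[OF lie, of z] by simp

lemma killing_nondegenerate:
  assumes "\<And>x. killing br x z = killing br x w"
  shows "z = w"
  using expand_ys[of z] expand_ys[of w] assms by simp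

text \<open>Expanding each \<open>ys a\<close> in the \<open>xs b\<close> produces the Gram matrix
  of \<open>ys\<close>, which is symmetric; it can therefore be absorbed into the other
  argument.\<close>

lemma sum_dual_swap:
  assumes "bilinear_form G"
  shows "(\<Sum>a\<in>UNIV. G (xs a) (ys a)) = (\<Sum>a\<in>UNIV. G (ys a) (xs a))"
proof -
  have "(\<Sum>a\<in>UNIV. G (xs a) (ys a)) = (\<Sum>a\<in>UNIV. G (xs a) (\<Sum>b\<in>UNIV. killing br (ys a) (ys b) *s xs b))"
    by (simp flip: expand_xs)
  also have "\<dots> = (\<Sum>b\<in>UNIV. \<Sum>a\<in>UNIV. killing br (ys a) (ys b) * G (xs a) (xs b))"
    by (subst sum.swap) (simp add: bilinear_form_sum[OF assms])
  also have "\<dots> = (\<Sum>b\<in>UNIV. G (\<Sum>a\<in>UNIV. killing br (ys b) (ys a) *s xs a) (xs b))"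
    by (simp add: bilinear_form_sum[OF assms] killing_sym[OF lie])
  finally show ?thesis by (simp flip: expand_xs)
qed

text \<open>This is the invariance of the canonical element, the sum of \<open>xs a\<close>
  \<otimes> \<open>ys a\<close>. Expand the bracket in \<open>ys\<close>, move \<open>b\<close>
  across by invariance of the Killing form, and recombine in \<open>xs\<close>.\<close>

lemma sum_dual_invariant:
  assumes "bilinear_form G"
  shows "(\<Sum>a\<in>UNIV. G (xs a) (br b (ys a))) = - (\<Sum>a\<in>UNIV. G (br b (xs a)) (ys a))"
proof -
  have k: "killing br (xs c) (br b (ys a)) = - killing br (br b (xs c)) (ys a)" for a c
  proof -
    have "killing br ((-1) *s u) v = (-1) * killing br u v" for u v
      using bilinear_form_killing[OF lie] unfolding bilinear_form_def by blast
    then show ?thesis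
      using killing_invariant[OF lie, of "xs c" b "ys a"] lie_bracket_antisym[OF lie, of "xs c" b]
      by simp
  qed
  have "(\<Sum>a\<in>UNIV. G (xs a) (br b (ys a)))
      = (\<Sum>a\<in>UNIV. G (xs a) (\<Sum>c\<in>UNIV. killing br (xs c) (br b (ys a)) *s ys c))"
    by (simp flip: expand_ys)
  also have "\<dots> = (\<Sum>a\<in>UNIV. \<Sum>c\<in>UNIV. killing br (xs c) (br b (ys a)) * G (xs a) (ys c))"
    by (simp only: bilinear_form_sum[OF assms])
  also have "\<dots> = (\<Sum>c\<in>UNIV. \<Sum>a\<in>UNIV. - (killing br (br b (xs c)) (ys a) * G (xs a) (ys c)))"
    by (subst sum.swap) (simp add: k)
  also have "\<dots> = - (\<Sum>c\<in>UNIV. G (\<Sum>a\<in>UNIV. killing br (br b (xs c)) (ys a) *s xs a) (ys c))"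
    by (simp add: bilinear_form_sum[OF assms] sum_negf)
  finally show ?thesis by (simp flip: expand_xs)
qed

lemma trace_eq_sum_dual:
  assumes T: "Vector_Spaces.linear (*s) (*s) T"
  shows "trace (matrix T) = (\<Sum>a\<in>UNIV. killing br (xs a) (T (ys a)))"
proof -
  note bf = bilinear_form_killing[OF lie]
  have "trace (matrix T) = (\<Sum>i\<in>UNIV. T (axis i 1) $ i)"
    by (simp add: trace_def matrix_def)
  also have "\<dots> = (\<Sum>i\<in>UNIV. T (\<Sum>a\<in>UNIV. killing br (xs a) (axis i 1) *s ys a) $ i)"
    by (simp flip: expand_ys)
  also have "\<dots> = (\<Sum>a\<in>UNIV. \<Sum>i\<in>UNIV. T (ys a) $ i * killing br (xs a) (axis i 1))"
    by (subst sum.swap) (simp add: vec.linear_sum[OF T] vec.linear_scale[OF T] mult.commute)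
  also have "\<dots> = (\<Sum>a\<in>UNIV. killing br (xs a) (\<Sum>i\<in>UNIV. T (ys a) $ i *s axis i 1))"
    by (simp add: bilinear_form_sum[OF bf])
  finally show ?thesis by (simp add: basis_expansion)
qed

text \<open>Paired with \<open>c\<close>, the left side becomes the trace of ad c ad b computed in
  dual bases, which is the Killing form of \<open>c\<close> and \<open>b\<close> by
  definition.\<close>

lemma adjoint_casimir: "(\<Sum>a\<in>UNIV. br (xs a) (br (ys a) b)) = b"
proof (rule killing_nondegenerate)
  fix c
  note bf = bilinear_form_killing[OF lie] and d = lie_algebraD[OF lie]
  have lin: "Vector_Spaces.linear (*s) (*s) (\<lambda>z. br c (br b z))"
    by (intro Vector_Spaces.linear_iff[THEN iffD2]) (auto simp: d vec.vector_space_axioms)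
  have 1: "killing br c (br (xs a) (br (ys a) b)) = killing br (xs a) (br c (br b (ys a)))" for a
  proof -
    have "killing br c (br (xs a) (br (ys a) b)) = killing br (br (xs a) (br (ys a) b)) c"
      by (rule killing_sym[OF lie])
    also have "\<dots> = killing br (xs a) (br (br (ys a) b) c)" by (rule killing_invariant[OF lie])
    also have "br (br (ys a) b) c = br c (br b (ys a))"
      by (metis lie_bracket_antisym[OF lie] d(8))
    finally show ?thesis .
  qed
  have "killing br c (\<Sum>a\<in>UNIV. br (xs a) (br (ys a) b))
      = (\<Sum>a\<in>UNIV. killing br c (br (xs a) (br (ys a) b)))"
    using bilinear_form_sum(2)[OF bf, of c "\<lambda>_. 1"] by simp
  also have "\<dots> = (\<Sum>a\<in>UNIV. killing br (xs a) (br c (br b (ys a))))" by (simp add: 1)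
  also have "\<dots> = killing br c b" using trace_eq_sum_dual[OF lin] by (simp add: killing_def)
  finally show "killing br c (\<Sum>a\<in>UNIV. br (xs a) (br (ys a) b)) = killing br c b" .
qed

subsection \<open>The Casimir operator\<close>

definition casimir :: "(complex ^ 'd \<Rightarrow> complex ^ 'n ^ 'n) \<Rightarrow> complex ^ 'n ^ 'n" where
  "casimir \<sigma> = (\<Sum>a\<in>UNIV. \<sigma> (xs a) ** \<sigma> (ys a))"

lemma sum_dual_rep_swap:
  assumes "lie_representation br \<sigma>"
  shows "(\<Sum>a\<in>UNIV. \<sigma> (xs a) ** M ** \<sigma> (ys a)) = (\<Sum>a\<in>UNIV. \<sigma> (ys a) ** M ** \<sigma> (xs a))"
  using sum_dual_swap[OF bilinear_form_rep_mult[OF assms]] by (simp add: vec_eq_iff)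

lemma casimir_swap:
  assumes "lie_representation br \<sigma>"
  shows "casimir \<sigma> = (\<Sum>a\<in>UNIV. \<sigma> (ys a) ** \<sigma> (xs a))"
  using sum_dual_rep_swap[OF assms, of "mat 1"] by (simp add: casimir_def)

lemma sum_dual_rep_invariant:
  assumes "lie_representation br \<sigma>"
  shows "(\<Sum>a\<in>UNIV. \<sigma> (xs a) ** \<sigma> (br b (ys a))) = - (\<Sum>a\<in>UNIV. \<sigma> (br b (xs a)) ** \<sigma> (ys a))"
  using sum_dual_invariant[OF bilinear_form_rep_mult[OF assms, of "mat 1"]] by (simp add: vec_eq_iff)

text \<open>The commutator of a product splits into two sums, which are negatives of each other by
  invariance of the canonical element.\<close>

lemma casimir_commute:
  assumes "lie_representation br \<sigma>"
  shows "casimir \<sigma> ** \<sigma> b = \<sigma> b ** casimir \<sigma>"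
proof -
  note r = lie_representationD[OF assms]
  have "casimir \<sigma> ** \<sigma> b - \<sigma> b ** casimir \<sigma>
      = - (\<Sum>a\<in>UNIV. \<sigma> (xs a) ** \<sigma> (br b (ys a)) + \<sigma> (br b (xs a)) ** \<sigma> (ys a))"
    by (simp add: casimir_def matrix_mult_sum_left matrix_mult_sum_right r matrix_mult_diff_left
       matrix_mult_diff_right matrix_mul_assoc sum_subtractf sum.distrib)
  also have "\<dots> = 0"
    using sum_dual_rep_invariant[OF assms] by (simp add: sum.distrib)
  finally show ?thesis by simp
qed

text \<open>Moving \<open>\<sigma> b\<close> to the right past \<open>\<sigma> (ys a)\<close> costs
  the correction \<open>Z\<close>. Applying \<open>\<sigma>\<close> to the adjoint Casimir identity
  expresses \<open>\<sigma> b\<close> as -2 \<open>Z\<close>, which is the origin of 1/2.\<close>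

lemma casimir_sandwich:
  assumes "lie_representation br \<sigma>"
  shows "(\<Sum>a\<in>UNIV. \<sigma> (xs a) ** \<sigma> b ** \<sigma> (ys a)) = casimir \<sigma> ** \<sigma> b - (1/2) *sm \<sigma> b"
proof -
  note r = lie_representationD[OF assms] and d = lie_algebraD[OF lie]
  define Z where "Z = (\<Sum>a\<in>UNIV. \<sigma> (xs a) ** \<sigma> (br b (ys a)))"
  have "bilinear_form (\<lambda>x y. (\<sigma> x ** \<sigma> (br b y)) $ i $ j)" for i j
    unfolding bilinear_form_def
    by (simp add: r(1,2) d smult_mat_mult_left smult_mat_mult_right
        matrix_add_rdistrib_mult matrix_add_ldistrib)
  \<comment> \<open>Exchanging the dual bases leaves \<open>Z\<close> unchanged; invariance then
    carries the bracket to the left factor at the price of a sign. So both halves of the commutator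
    below contribute the same.\<close>
  then have Z': "Z = (\<Sum>a\<in>UNIV. \<sigma> (ys a) ** \<sigma> (br b (xs a)))"
    using sum_dual_swap[of "\<lambda>x y. (\<sigma> x ** \<sigma> (br b y)) $ i $ j" for i j]
    unfolding Z_def by (simp add: vec_eq_iff)
  have Z'': "Z = - (\<Sum>a\<in>UNIV. \<sigma> (br b (ys a)) ** \<sigma> (xs a))"
    unfolding Z' using killing_dual_bases.sum_dual_rep_invariant[OF swapped assms] .
  have neg: "\<sigma> (br y b) = - \<sigma> (br b y)" for y
    using lie_bracket_antisym[OF lie, of y b] by (simp add: r(5))
  have "\<sigma> b = (\<Sum>a\<in>UNIV. \<sigma> (br (xs a) (br (ys a) b)))"
    using adjoint_casimir[of b] r(7)[of "\<lambda>a. br (xs a) (br (ys a) b)" UNIV] by simp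
  also have "\<dots> = (\<Sum>a\<in>UNIV. \<sigma> (xs a) ** \<sigma> (br (ys a) b)) - (\<Sum>a\<in>UNIV. \<sigma> (br (ys a) b) ** \<sigma> (xs a))"
    by (subst r(3)) (simp add: sum_subtractf)
  also have "(\<Sum>a\<in>UNIV. \<sigma> (xs a) ** \<sigma> (br (ys a) b)) = - Z"
    unfolding Z_def neg by (simp add: vec_eq_iff matrix_matrix_mult_def sum_negf)
  also have "(\<Sum>a\<in>UNIV. \<sigma> (br (ys a) b) ** \<sigma> (xs a)) = Z"
    unfolding Z'' neg by (simp add: vec_eq_iff matrix_matrix_mult_def sum_negf)
  finally have Zb: "Z = - ((1/2) *sm \<sigma> b)" by (simp add: vec_eq_iff)
  have "(\<Sum>a\<in>UNIV. \<sigma> (xs a) ** \<sigma> b ** \<sigma> (ys a)) = (\<Sum>a\<in>UNIV. \<sigma> (xs a) ** \<sigma> (ys a) ** \<sigma> b) + Z"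
    unfolding Z_def r(3)
    by (simp add: matrix_mult_diff_right matrix_mul_assoc sum_subtractf)
  then show ?thesis by (simp add: Zb casimir_def matrix_mult_sum_left)
qed

text \<open>The two minus signs cancel, and the order reversed by transposition is restored by
  exchanging the dual bases. Hence a scalar Casimir operator has the same eigenvalue on the
  dual.\<close>

lemma casimir_dual_rep:
  assumes "lie_representation br \<sigma>"
  shows "casimir (dual_rep \<sigma>) = transpose (casimir \<sigma>)"
proof -
  have "transpose (casimir \<sigma>) = (\<Sum>a\<in>UNIV. transpose (\<sigma> (ys a) ** \<sigma> (xs a)))"
    unfolding casimir_swap[OF assms] by (simp add: vec_eq_iff transpose_def)
  also have "\<dots> = (\<Sum>a\<in>UNIV. transpose (\<sigma> (xs a)) ** transpose (\<sigma> (ys a)))"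
    by (simp add: matrix_transpose_mul)
  also have "\<dots> = casimir (dual_rep \<sigma>)"
    unfolding casimir_def dual_rep_def by (simp add: vec_eq_iff matrix_matrix_mult_def)
  finally show ?thesis by simp
qed

lemma Omega_swap:
  assumes "lie_representation br \<rho>"
  shows "Omega \<rho> ys xs = Omega \<rho> xs ys"
  using sum_dual_swap[OF bilinear_form_rep_kronecker[OF assms]] by (simp add: vec_eq_iff Omega_def)

text \<open>The two mixed terms are \<open>Omega\<close> for the two orders of the dual bases, and
  these agree.\<close>

lemma casimir_tensor_rep:
  assumes "lie_representation br \<rho>"
  shows "casimir (tensor_rep \<rho> \<rho>) = casimir \<rho> \<otimes>\<^sub>k mat 1 + mat 1 \<otimes>\<^sub>k casimir \<rho> + 2 *sm Omega \<rho> xs ys"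
proof -
  have "casimir (tensor_rep \<rho> \<rho>) = (\<Sum>a\<in>UNIV. (\<rho> (xs a) ** \<rho> (ys a)) \<otimes>\<^sub>k mat 1)
    + (\<Sum>a\<in>UNIV. mat 1 \<otimes>\<^sub>k (\<rho> (xs a) ** \<rho> (ys a))) + Omega \<rho> xs ys + Omega \<rho> ys xs"
    by (simp add: casimir_def tensor_rep_def matrix_add_ldistrib matrix_add_rdistrib_mult kronecker_mult
       sum.distrib Omega_def)
  also have "(\<Sum>a\<in>UNIV. (\<rho> (xs a) ** \<rho> (ys a)) \<otimes>\<^sub>k mat 1) = casimir \<rho> \<otimes>\<^sub>k mat 1"
    by (simp add: vec_eq_iff kronecker_def casimir_def sum_distrib_right)
  also have "(\<Sum>a\<in>UNIV. mat 1 \<otimes>\<^sub>k (\<rho> (xs a) ** \<rho> (ys a))) = mat 1 \<otimes>\<^sub>k casimir \<rho>"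
    by (simp add: vec_eq_iff kronecker_def casimir_def sum_distrib_left)
  finally show ?thesis
    by (simp add: Omega_swap[OF assms] vec_eq_iff)
qed

lemma trace_flip_Omega: "trace (flip ** Omega \<rho> xs ys) = trace (casimir \<rho>)"
  by (simp add: Omega_def matrix_mult_sum_right trace_sum trace_flip_kronecker casimir_def)

lemma trace_Omega:
  assumes "\<And>x. trace (\<rho> x) = 0"
  shows "trace (Omega \<rho> xs ys) = 0"
  by (simp add: Omega_def trace_sum trace_kronecker assms)

lemma Omega_square: "Omega \<rho> xs ys ** Omega \<rho> xs ys
   = (\<Sum>a\<in>UNIV. \<Sum>b\<in>UNIV. (\<rho> (xs a) ** \<rho> (xs b)) \<otimes>\<^sub>k (\<rho> (ys a) ** \<rho> (ys b)))"
  by (simp add: Omega_def matrix_mult_sum_left matrix_mult_sum_right kronecker_mult) (rule sum.swap)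

text \<open>The flip strings the factors into the cyclic word xs a, xs b, ys a, ys b. The sum over a
  is a sandwich around \<open>\<rho> (xs b)\<close>, and what remains is again the Casimir
  sum.\<close>

lemma trace_flip_Omega_square:
  assumes "lie_representation br \<rho>" "casimir \<rho> = C *sm mat 1"
  shows "trace (flip ** (Omega \<rho> xs ys ** Omega \<rho> xs ys)) = (C - 1/2) * trace (casimir \<rho>)"
proof -
  have "trace (flip ** (Omega \<rho> xs ys ** Omega \<rho> xs ys))
     = (\<Sum>b\<in>UNIV. trace ((\<Sum>a\<in>UNIV. \<rho> (xs a) ** \<rho> (xs b) ** \<rho> (ys a)) ** \<rho> (ys b)))"
    unfolding Omega_square matrix_mult_sum_left matrix_mult_sum_right trace_sum trace_flip_kronecker
    by (subst sum.swap) (simp add: matrix_mul_assoc)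
  also have "\<dots> = (\<Sum>b\<in>UNIV. (C - 1/2) * trace (\<rho> (xs b) ** \<rho> (ys b)))"
    by (simp add: casimir_sandwich[OF assms(1)] assms(2) matrix_mult_diff_left smult_mat_mult_left trace_sub trace_smult_mat algebra_simps)
  finally show ?thesis by (simp add: casimir_def trace_sum sum_distrib_left)
qed

text \<open>The trace reduces to the sum of products of entries of the Gram matrices of
  \<open>xs\<close> and \<open>ys\<close>. These matrices are inverse to each other, so every index
  a contributes 1.\<close>

lemma trace_Omega_square:
  assumes "\<And>x y. trace (\<rho> x ** \<rho> y) = k * killing br x y"
  shows "trace (Omega \<rho> xs ys ** Omega \<rho> xs ys) = k\<^sup>2 * of_nat CARD('d)"
proof -
  note bf = bilinear_form_killing[OF lie]
  have "(\<Sum>b\<in>UNIV. killing br (xs a) (xs b) * killing br (ys a) (ys b)) = 1" for a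
  proof -
    have "(\<Sum>b\<in>UNIV. killing br (xs a) (xs b) * killing br (ys a) (ys b))
      = killing br (xs a) (\<Sum>b\<in>UNIV. killing br (ys a) (ys b) *s xs b)"
      by (simp add: bilinear_form_sum[OF bf] mult.commute)
    then show ?thesis using dual by (simp flip: expand_xs add: dual_bases_def)
  qed
  then have "(\<Sum>a\<in>UNIV. \<Sum>b\<in>UNIV. k\<^sup>2 * (killing br (xs a) (xs b) * killing br (ys a) (ys b))) = k\<^sup>2 * of_nat CARD('d)"
    by (simp flip: sum_distrib_left)
  then show ?thesis
    unfolding Omega_square trace_sum trace_kronecker assms by (simp add: power2_eq_square ac_simps)
qed

lemma trace_casimir:
  assumes "\<And>x y. trace (\<rho> x ** \<rho> y) = k * killing br x y"
  shows "trace (casimir \<rho>) = k * of_nat CARD('d)"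
  using dual by (simp add: casimir_def trace_sum assms dual_bases_def)

text \<open>Schur's lemma for the adjoint representation: \<open>\<phi>\<close> represents the trace
  form through the Killing form and commutes with brackets, so an eigenspace of it is a nonzero
  ideal and hence everything.\<close>

lemma trace_form_eq_killing:
  assumes rep: "lie_representation br \<rho>"
    and simple: "simple_lie_algebra br"
  obtains k where "\<And>x y. trace (\<rho> x ** \<rho> y) = k * killing br x y"
proof -
  note bf = bilinear_form_killing[OF lie] and bt = bilinear_form_trace[OF rep] and d = lie_algebraD[OF lie]
  define \<phi> where "\<phi> z = (\<Sum>a\<in>UNIV. trace (\<rho> (xs a) ** \<rho> z) *s ys a)" for z
  have \<phi>: "killing br x (\<phi> z) = trace (\<rho> x ** \<rho> z)" for x z
  proof -
    have "trace (\<rho> x ** \<rho> z) = trace (\<rho> (\<Sum>a\<in>UNIV. killing br x (ys a) *s xs a) ** \<rho> z)"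
      by (simp flip: expand_xs)
    also have "\<dots> = (\<Sum>a\<in>UNIV. killing br x (ys a) * trace (\<rho> (xs a) ** \<rho> z))"
      by (rule bilinear_form_sum(1)[OF bt])
    also have "\<dots> = killing br x (\<phi> z)"
      unfolding \<phi>_def by (simp add: bilinear_form_sum[OF bf] mult.commute)
    finally show ?thesis by simp
  qed
  have lin: "Vector_Spaces.linear (*s) (*s) \<phi>"
    using bt bf by (intro Vector_Spaces.linear_iff[THEN iffD2] conjI allI vec.vector_space_axioms killing_nondegenerate)
      (simp_all add: bilinear_form_def \<phi>)
  obtain k y where y: "y \<noteq> 0" "\<phi> y = k *s y"
    using exists_eigenvector[of "matrix \<phi>"] by (auto simp: matrix_works[OF lin])
  define J where "J = {z. \<phi> z = k *s z}"
  have "\<phi> (br x z) = k *s br x z" if "\<phi> z = k *s z" for x z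
  proof (rule killing_nondegenerate)
    fix w
    have "killing br w (\<phi> (br x z)) = killing br (br w x) (\<phi> z)"
      by (simp add: \<phi> trace_form_invariant[OF rep])
    also have "\<dots> = killing br w (br x (k *s z))" by (simp add: that killing_invariant[OF lie])
    finally show "killing br w (\<phi> (br x z)) = killing br w (k *s br x z)" by (simp add: d)
  qed
  moreover have "vec.subspace J"
    unfolding J_def
    by (auto simp: vec.subspace_def vec.linear_0[OF lin] vec.linear_add[OF lin] vec.linear_scale[OF lin]
        vector_add_ldistrib vector_smult_assoc mult.commute)
  ultimately have "lie_ideal br J" unfolding lie_ideal_def J_def by blast
  then have "J = UNIV" using simple y unfolding simple_lie_algebra_def J_def by auto
  then have "\<phi> z = k *s z" for z unfolding J_def by blast
  then have "trace (\<rho> x ** \<rho> z) = k * killing br x z" for x z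
    using \<phi>[of x z] bf by (simp add: bilinear_form_def)
  then show thesis by (rule that)
qed

text \<open>The kernel of \<open>\<rho>\<close> is an ideal, so \<open>\<rho>\<close> is injective,
  and a vanishing \<open>Omega\<close> would make all matrix coefficients vanish. This discards the
  zero solution of the homogeneous trace equations.\<close>

lemma Omega_nonzero:
  assumes rep: "lie_representation br \<rho>" and simple: "simple_lie_algebra br" and nz: "\<rho> x \<noteq> 0"
  shows "Omega \<rho> xs ys \<noteq> 0"
proof
  assume O: "Omega \<rho> xs ys = 0"
  note r = lie_representationD[OF rep] and bf = bilinear_form_killing[OF lie]
  have "lie_ideal br {z. \<rho> z = 0}"
    unfolding lie_ideal_def vec.subspace_def by (auto simp: r smult_mat_0)
  then have inj: "z = 0" if "\<rho> z = 0" for z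
    using simple nz that unfolding simple_lie_algebra_def by auto
  \<comment> \<open>Contracting the first tensor factor of \<open>Omega\<close> with a matrix
    coordinate gives the image of this element.\<close>
  have "\<rho> (\<Sum>a\<in>UNIV. (\<rho> (xs a) $ i $ j) *s ys a) = 0" for i j
  proof -
    have "(\<Sum>a\<in>UNIV. \<rho> (xs a) $ i $ j * \<rho> (ys a) $ k $ l) = Omega \<rho> xs ys $ (i, k) $ (j, l)" for k l
      by (simp add: Omega_def kronecker_def)
    then show ?thesis by (simp add: r vec_eq_iff O)
  qed
  then have z: "(\<Sum>a\<in>UNIV. (\<rho> (xs a) $ i $ j) *s ys a) = 0" for i j by (rule inj)
  have "\<rho> (xs b) $ i $ j = 0" for b i j
  proof -
    have "killing br (xs b) (\<Sum>a\<in>UNIV. (\<rho> (xs a) $ i $ j) *s ys a) = \<rho> (xs b) $ i $ j"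
      using dual by (simp add: bilinear_form_sum[OF bf] dual_bases_def
          if_distrib[where f = "(*) _"] cong: if_cong)
    \<comment> \<open>On the empty index set the sum rule says that the form vanishes at 0.\<close>
    then show ?thesis using z bilinear_form_sum(2)[OF bf, of _ _ _ "{}"] by simp
  qed
  then have "\<rho> (xs b) = 0" for b by (simp add: vec_eq_iff)
  then have "\<rho> x = 0"
    by (subst expand_xs[of x]) (simp add: r vec_eq_iff)
  then show False using nz by contradiction
qed

end

subsection \<open>Highest weight vectors\<close>

lemma span_mult_closed:
  assumes "\<And>s. s \<in> S \<Longrightarrow> A *v s \<in> vec.span S" and "x \<in> vec.span S"
  shows "A *v x \<in> vec.span (S :: (complex ^ 'n) set)"
  using assms(2)
proof (induction rule: vec.span_induct_alt)
  case (step c x y)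
  then show ?case
    using assms(1) by (simp add: matrix_vector_right_distrib vec.scale vec.span_add vec.span_scale)
qed (simp add: vec.span_zero)

lemma scalar_on_irreducible_submodule:
  assumes irr: "irreducible_submodule \<sigma> Y" and comm: "\<And>x. M ** \<sigma> x = \<sigma> x ** M"
    and y: "y \<in> Y" "y \<noteq> 0" "M *v y = c *s y" and z: "z \<in> Y"
  shows "M *v z = c *s z"
proof -
  have Y: "submodule \<sigma> Y" using irr by (simp add: irreducible_submodule_def)
  let ?R = "{z \<in> Y. M *v z = c *s z}"
  have "M *v (\<sigma> x *v z) = c *s (\<sigma> x *v z)" if "M *v z = c *s z" for x z
    by (metis comm matrix_vector_mul_assoc that vec.scale)
  moreover have "vec.subspace ?R"
    using Y unfolding submodule_def vec.subspace_def
    by (auto simp: matrix_vector_right_distrib vec.scale vector_add_ldistrib vector_smult_assoc mult.commute)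
  ultimately have "submodule \<sigma> ?R" using Y unfolding submodule_def by blast
  then have "?R = {0} \<or> ?R = Y" using irr unfolding irreducible_submodule_def by blast
  then show ?thesis using y z by blast
qed

definition height_coeff :: "nat \<Rightarrow> nat" where
  "height_coeff i = [16, 22, 30, 42, 30, 16] ! (i - 1)"

lemma height_coeff_cartan:
  assumes "j \<in> {1..6}"
  shows "(\<Sum>i\<in>{1..6}. int (height_coeff i) * e6_cartan i j) = 2"
proof -
  have "{1..6} = {1, 2, 3, 4, 5, 6::nat}" by auto
  then show ?thesis
    using assms by (auto simp: height_coeff_def e6_cartan_def doubleton_eq_iff)
qed

lemma sum_1_6: "(\<Sum>i\<in>{1..6::nat}. f i) = f 1 + f 2 + f 3 + f 4 + f 5 + (f 6 :: 'a::comm_monoid_add)"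
proof -
  have "{1..6} = {1, 2, 3, 4, 5, 6::nat}" by auto
  then show ?thesis by (simp add: add_ac)
qed

section \<open>Chevalley generators and cyclic modules\<close>

locale e6 =
  fixes br :: "'d::finite bracket" and E F H :: "nat \<Rightarrow> complex ^ 'd"
  assumes e6: "e6_lie_algebra br E F H"
begin

lemma simple: "simple_lie_algebra br" and lie_alg: "lie_algebra br"
  using e6 by (auto simp: e6_lie_algebra_def simple_lie_algebra_def)

lemma bracket_EF: "i \<in> {1..6} \<Longrightarrow> j \<in> {1..6} \<Longrightarrow> br (E i) (F j) = (if i = j then H i else 0)"
  and bracket_HE: "i \<in> {1..6} \<Longrightarrow> j \<in> {1..6} \<Longrightarrow> br (H i) (E j) = of_int (e6_cartan i j) *s E j"
  and bracket_HF: "i \<in> {1..6} \<Longrightarrow> j \<in> {1..6} \<Longrightarrow> br (H i) (F j) = - of_int (e6_cartan i j) *s F j"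
  and generated: "lie_subalgebra br S \<Longrightarrow> (\<And>i. i \<in> {1..6} \<Longrightarrow> E i \<in> S \<and> F i \<in> S \<and> H i \<in> S) \<Longrightarrow> S = UNIV"
  using e6 unfolding e6_lie_algebra_def by blast+

text \<open>Traces of brackets vanish, and up to the factors 2 and -2 every Chevalley generator is a
  bracket.\<close>

lemma trace_rep_zero:
  assumes "lie_representation br \<sigma>"
  shows "trace (\<sigma> x) = 0"
proof -
  note r = lie_representationD[OF assms]
  let ?S = "{x. trace (\<sigma> x) = 0}"
  have t: "trace (\<sigma> (br x y)) = 0" for x y
    using trace_mul_sym[of "\<sigma> x" "\<sigma> y"] by (simp add: r trace_sub)
  have tz: "trace (0 :: complex ^ 'b ^ 'b) = 0" by (simp add: trace_def)
  have tm: "trace (- A) = - trace A" for A :: "complex ^ 'b ^ 'b" by (simp add: trace_def sum_negf)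
  have sub: "lie_subalgebra br ?S"
    unfolding lie_subalgebra_def vec.subspace_def
    using t by (simp add: r(1,2,4) tz trace_add trace_smult_mat)
  have "E i \<in> ?S \<and> F i \<in> ?S \<and> H i \<in> ?S" if i: "i \<in> {1..6}" for i
  proof -
    have "trace (\<sigma> (H i)) = 0" using t[of "E i" "F i"] bracket_EF[OF i i] by simp
    moreover have "trace (\<sigma> (E i)) = 0"
      using t[of "H i" "E i"] bracket_HE[OF i i] by (simp add: r(2) trace_smult_mat e6_cartan_def)
    moreover have "trace (\<sigma> (F i)) = 0"
      using t[of "H i" "F i"] bracket_HF[OF i i] by (simp add: r(2,5) trace_smult_mat tm e6_cartan_def)
    ultimately show ?thesis by simp
  qed
  then have "?S = UNIV" by (intro generated[OF sub])
  then show ?thesis by blast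
qed

text \<open>The elements preserving \<open>S\<close> form a subalgebra, which contains each
  \<open>H i\<close> as the bracket of \<open>E i\<close> and \<open>F i\<close>.\<close>

lemma submodule_generators:
  assumes rep: "lie_representation br \<sigma>" and S: "vec.subspace S"
    and E: "\<And>i v. i \<in> {1..6} \<Longrightarrow> v \<in> S \<Longrightarrow> \<sigma> (E i) *v v \<in> S"
    and F: "\<And>i v. i \<in> {1..6} \<Longrightarrow> v \<in> S \<Longrightarrow> \<sigma> (F i) *v v \<in> S"
  shows "submodule \<sigma> S"
proof -
  note r = lie_representationD[OF rep]
  let ?T = "{x. \<forall>v\<in>S. \<sigma> x *v v \<in> S}"
  have br: "\<sigma> (br x y) *v v \<in> S" if "x \<in> ?T" "y \<in> ?T" "v \<in> S" for x y v
    using that by (auto simp: r(3) matrix_vector_mult_diff_rdistrib matrix_vector_mul_assoc[symmetric]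
      intro!: vec.subspace_diff[OF S])
  have sub: "lie_subalgebra br ?T"
    unfolding lie_subalgebra_def
  proof (intro conjI ballI)
    show "vec.subspace ?T"
      unfolding vec.subspace_def
      by (auto simp: r(1,2,4) matrix_vector_mult_add_rdistrib smult_mat_mult_vec
          intro: vec.subspace_add[OF S] vec.subspace_scale[OF S] vec.subspace_0[OF S])
  qed (use br in blast)
  have "E i \<in> ?T \<and> F i \<in> ?T \<and> H i \<in> ?T" if i: "i \<in> {1..6}" for i
  proof -
    have "E i \<in> ?T" "F i \<in> ?T" using E F i by blast+
    then show ?thesis using br[of "E i" "F i"] bracket_EF[OF i i] by simp
  qed
  then have "?T = UNIV" by (intro generated[OF sub])
  then show ?thesis using S unfolding submodule_def by blast
qed

text \<open>The coefficients are those of the sum of the positive coroots, so that the height element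
  takes the value 2 on each simple root.\<close>

definition height :: "complex ^ 'd" where
  "height = (\<Sum>i\<in>{1..6}. of_nat (height_coeff i) *s H i)"

lemma bracket_height_F:
  assumes j: "j \<in> {1..6}"
  shows "br height (F j) = - 2 *s F j"
proof -
  have "br height (F j) = (\<Sum>i\<in>{1..6}. of_nat (height_coeff i) *s br (H i) (F j))"
    by (simp add: height_def lie_algebraD[OF lie_alg])
  also have "\<dots> = (\<Sum>i\<in>{1..6}. of_int (- (int (height_coeff i) * e6_cartan i j)) *s F j)"
    using bracket_HF j by (intro sum.cong) (auto simp: vector_smult_assoc)
  also have "\<dots> = of_int (- (\<Sum>i\<in>{1..6}. int (height_coeff i) * e6_cartan i j)) *s F j"
    by (simp only: vec.scale_sum_left[symmetric] of_int_sum[symmetric] sum_negf)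
  finally show ?thesis unfolding height_coeff_cartan[OF j] by simp
qed

lemma height_highest_weight:
  assumes rep: "lie_representation br \<sigma>"
    and "\<And>i. i \<in> {1..6} \<Longrightarrow> \<sigma> (H i) *v v = of_nat (w i) *s v"
  shows "\<sigma> height *v v = of_nat (\<Sum>i\<in>{1..6}. height_coeff i * w i) *s v"
proof -
  note r = lie_representationD[OF rep]
  have "\<sigma> height *v v = (\<Sum>i\<in>{1..6}. of_nat (height_coeff i) *s (\<sigma> (H i) *v v))"
    by (simp add: height_def r(2,7) matrix_vector_mult_sum_left smult_mat_mult_vec)
  also have "\<dots> = (\<Sum>i\<in>{1..6}. of_nat (height_coeff i * w i) *s v)"
    using assms(2) by (intro sum.cong) (auto simp: vector_smult_assoc)
  finally show ?thesis by (simp only: vec.scale_sum_left[symmetric] of_nat_sum)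
qed

text \<open>Words of length \<open>k\<close> in the lowering operators applied to \<open>v\<close>.
  Some of them may be zero, which is why 0 appears in the spanning sets below.\<close>

primrec descendants :: "(complex ^ 'd \<Rightarrow> complex ^ 'n ^ 'n) \<Rightarrow> complex ^ 'n \<Rightarrow> nat \<Rightarrow> (complex ^ 'n) set" where
  "descendants \<sigma> v 0 = {v}"
| "descendants \<sigma> v (Suc k) = {\<sigma> (F i) *v m | i m. i \<in> {1..6} \<and> m \<in> descendants \<sigma> v k}"

lemma rep_commute_vec:
  assumes "lie_representation br \<sigma>"
  shows "\<sigma> x *v (\<sigma> y *v v) = \<sigma> y *v (\<sigma> x *v v) + \<sigma> (br x y) *v v"
  by (simp add: lie_representationD(3)[OF assms] matrix_vector_mult_diff_rdistrib matrix_vector_mul_assoc)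

lemma descendants_height:
  assumes rep: "lie_representation br \<sigma>" and v: "\<sigma> height *v v = n *s v"
    and m: "m \<in> descendants \<sigma> v k"
  shows "\<sigma> height *v m = (n - 2 * of_nat k) *s m"
  using m
proof (induction k arbitrary: m)
  case (Suc k)
  then obtain i m' where i: "i \<in> {1..6}" "m' \<in> descendants \<sigma> v k" "m = \<sigma> (F i) *v m'" by auto
  have "\<sigma> height *v m = (n - 2 * of_nat k) *s m + (-2) *s m"
    unfolding i(3) rep_commute_vec[OF rep, of height] Suc.IH[OF i(2)] bracket_height_F[OF i(1)]
    by (simp only: lie_representationD(2)[OF rep] smult_mat_mult_vec vec.scale)
  then show ?case by (simp only: vector_sadd_rdistrib[symmetric]) (simp add: algebra_simps)
qed (use v in simp)

lemma descendants_weight: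
  assumes rep: "lie_representation br \<sigma>" and v: "\<And>i. i \<in> {1..6} \<Longrightarrow> \<exists>c. \<sigma> (H i) *v v = c *s v"
    and m: "m \<in> descendants \<sigma> v k" and i: "i \<in> {1..6}"
  shows "\<exists>c. \<sigma> (H i) *v m = c *s m"
  using m
proof (induction k arbitrary: m)
  case (Suc k)
  then obtain j m' where j: "j \<in> {1..6}" "m' \<in> descendants \<sigma> v k" "m = \<sigma> (F j) *v m'" by auto
  obtain c where c: "\<sigma> (H i) *v m' = c *s m'" using Suc.IH[OF j(2)] by blast
  have "\<sigma> (H i) *v m = c *s m + (- of_int (e6_cartan i j)) *s m"
    unfolding j(3) rep_commute_vec[OF rep, of "H i"] c bracket_HF[OF i j(1)]
    by (simp only: lie_representationD(2)[OF rep] smult_mat_mult_vec vec.scale)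
  then show ?case by (simp only: vector_sadd_rdistrib[symmetric]) blast
qed (use v i in simp)

text \<open>Push the raising operator through the first lowering operator. The commutator is 0 or
  \<open>H i\<close>, which acts by a scalar on a descendant, and the other term is covered by
  induction.\<close>

lemma descendants_raise:
  assumes rep: "lie_representation br \<sigma>" and v: "\<And>i. i \<in> {1..6} \<Longrightarrow> \<exists>c. \<sigma> (H i) *v v = c *s v"
    and Ev: "\<And>i. i \<in> {1..6} \<Longrightarrow> \<sigma> (E i) *v v = 0"
    and m: "m \<in> descendants \<sigma> v k" and i: "i \<in> {1..6}"
  shows "\<sigma> (E i) *v m \<in> vec.span (\<Union>k. descendants \<sigma> v k)"
  using m
proof (induction k arbitrary: m)
  case (Suc k)
  let ?S = "vec.span (\<Union>k. descendants \<sigma> v k)"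
  obtain j m' where j: "j \<in> {1..6}" "m' \<in> descendants \<sigma> v k" "m = \<sigma> (F j) *v m'" using Suc.prems by auto
  have "\<sigma> (F j) *v s \<in> ?S" if s: "s \<in> (\<Union>k. descendants \<sigma> v k)" for s
  proof -
    obtain l where "s \<in> descendants \<sigma> v l" using s by blast
    then have "\<sigma> (F j) *v s \<in> descendants \<sigma> v (Suc l)" using j(1) by auto
    then show ?thesis by (intro vec.span_base) blast
  qed
  then have 1: "\<sigma> (F j) *v (\<sigma> (E i) *v m') \<in> ?S"
    using Suc.IH[OF j(2)] by (rule span_mult_closed)
  obtain c where c: "\<sigma> (H i) *v m' = c *s m'" using descendants_weight[OF rep v j(2) i] by blast
  have "m' \<in> ?S" using j(2) by (intro vec.span_base) blast
  then have "\<sigma> (br (E i) (F j)) *v m' \<in> ?S"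
    using bracket_EF[OF i j(1)] c
    by (auto simp: lie_representationD(4)[OF rep] vec.span_zero intro: vec.span_scale)
  then show ?case
    unfolding j(3) rep_commute_vec[OF rep, of "E i"] using 1 by (rule vec.span_add[rotated])
qed (use Ev i in \<open>simp add: vec.span_zero\<close>)

lemma descendants_span:
  assumes rep: "lie_representation br \<sigma>" and irr: "irreducible_submodule \<sigma> UNIV" and "v \<noteq> 0"
    and v: "\<And>i. i \<in> {1..6} \<Longrightarrow> \<exists>c. \<sigma> (H i) *v v = c *s v"
    and Ev: "\<And>i. i \<in> {1..6} \<Longrightarrow> \<sigma> (E i) *v v = 0"
  shows "vec.span (\<Union>k. descendants \<sigma> v k) = UNIV"
proof -
  let ?D = "\<Union>k. descendants \<sigma> v k"
  have "submodule \<sigma> (vec.span ?D)"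
  proof (rule submodule_generators[OF rep vec.subspace_span])
    fix i :: nat and x assume i: "i \<in> {1..6}" and x: "x \<in> vec.span ?D"
    show "\<sigma> (E i) *v x \<in> vec.span ?D"
      using descendants_raise[OF rep v Ev _ i] by (intro span_mult_closed[OF _ x]) blast
    have "\<sigma> (F i) *v s \<in> vec.span ?D" if s: "s \<in> ?D" for s
    proof -
      obtain l where "s \<in> descendants \<sigma> v l" using s by blast
      then have "\<sigma> (F i) *v s \<in> descendants \<sigma> v (Suc l)" using i by auto
      then show ?thesis by (intro vec.span_base) blast
    qed
    then show "\<sigma> (F i) *v x \<in> vec.span ?D" by (rule span_mult_closed[OF _ x])
  qed
  moreover have "v \<in> vec.span ?D" by (intro vec.span_base UN_I[of 0]) auto
  ultimately show ?thesis using irr \<open>v \<noteq> 0\<close> unfolding irreducible_submodule_def by blast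
qed

end

section \<open>The representation with the sixth fundamental weight\<close>

locale e6_minuscule = e6 br E F H
  for br :: "'d::finite bracket" and E F H :: "nat \<Rightarrow> complex ^ 'd" +
  fixes \<rho> :: "complex ^ 'd \<Rightarrow> complex ^ 'n ^ 'n::finite" and v :: "complex ^ 'n"
  assumes rep: "lie_representation br \<rho>" and irr: "irreducible_submodule \<rho> UNIV"
    and v0: "v \<noteq> 0" and Ev: "\<And>i. i \<in> {1..6} \<Longrightarrow> \<rho> (E i) *v v = 0"
    and Hv: "\<And>i. i \<in> {1..6} \<Longrightarrow> \<rho> (H i) *v v = of_nat ([0, 0, 0, 0, 0, 1] ! (i - 1)) *s v"
begin

lemma height_v: "\<rho> height *v v = 16 *s v"
  using height_highest_weight[OF rep Hv] unfolding sum_1_6 by (simp add: height_coeff_def)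

abbreviation "D \<equiv> descendants \<rho> v"

lemma span_D: "vec.span (\<Union>k. D k) = UNIV"
  using Hv Ev by (intro descendants_span[OF rep irr v0]) blast+

lemma height_D: "m \<in> D k \<Longrightarrow> \<rho> height *v m = (16 - 2 * of_nat k) *s m"
  by (rule descendants_height[OF rep height_v])

text \<open>Since \<open>H i\<close> kills \<open>v\<close>, a nonzero \<open>F i\<close> image
  would be a second vector killed by all raising operators, at height 14. Its descendants would span
  V with heights at most 14, leaving no room for \<open>v\<close> at height 16.\<close>

lemma F_v:
  assumes i: "i \<in> {1..5}"
  shows "\<rho> (F i) *v v = 0"
proof (rule ccontr)
  let ?u = "\<rho> (F i) *v v"
  assume u0: "?u \<noteq> 0"
  have i6: "i \<in> {1..6}" using i by auto
  have "[0, 0, 0, 0, 0, 1] ! (i - 1) = (0::nat)"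
    using i by (auto simp: nth_Cons split: nat.split)
  then have Hi: "\<rho> (H i) *v v = 0" using Hv[OF i6] by simp
  have uE: "\<rho> (E j) *v ?u = 0" if j: "j \<in> {1..6}" for j
    unfolding rep_commute_vec[OF rep, of "E j"] Ev[OF j] bracket_EF[OF j i6]
    using Hi by (auto simp: lie_representationD(4)[OF rep])
  have uD: "?u \<in> D 1" using i6 by auto
  have uH: "\<exists>c. \<rho> (H j) *v ?u = c *s ?u" if "j \<in> {1..6}" for j
    using descendants_weight[OF rep _ uD that] Hv by blast
  have hu: "\<rho> height *v ?u = 14 *s ?u" using height_D[OF uD] by simp
  let ?L = "\<Union>k. descendants \<rho> ?u k"
  have hL: "\<exists>k. \<rho> height *v m = (14 - 2 * of_nat k) *s m" if "m \<in> ?L" for m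
    using that descendants_height[OF rep hu] by blast
  have "v \<in> vec.span {m \<in> ?L. \<rho> height *v m = 16 *s m}"
    using descendants_span[OF rep irr u0 uH uE] hL height_v
    by (intro eigenvector_in_span_eigenvectors) blast+
  moreover have "m = 0" if m: "m \<in> ?L" "\<rho> height *v m = 16 *s m" for m
  proof -
    obtain k where "(14 - 2 * of_nat k) *s m = 16 *s m" using hL[OF m(1)] m(2) by metis
    then have "14 - 2 * of_nat k = (16::complex) \<or> m = 0" by (simp only: vector_mul_rcancel)
    \<comment> \<open>The eigenvalues are complex numbers, so the bound 14 is applied to real
      parts.\<close>
    moreover have "14 - 2 * of_nat k \<noteq> (16::complex)"
    proof
      assume "14 - 2 * of_nat k = (16::complex)"
      then have "Re (14 - 2 * of_nat k) = Re 16" by (rule arg_cong)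
      then show False by simp
    qed
    ultimately show ?thesis by blast
  qed
  then have "{m \<in> ?L. \<rho> height *v m = 16 *s m} \<subseteq> {0}" by blast
  ultimately have "v \<in> vec.span {0}" using vec.span_mono by blast
  then show False using v0 by simp
qed

definition f where "f = \<rho> (F 6) *v v"

lemma E6_f: "\<rho> (E 6) *v f = v"
  unfolding f_def rep_commute_vec[OF rep, of "E 6"]
  using Ev[of 6] Hv[of 6] bracket_EF[of 6 6] by simp

lemma D_1: "m \<in> D 1 \<Longrightarrow> m = 0 \<or> m = f"
proof -
  assume "m \<in> D 1"
  then obtain i where i: "i \<in> {1..6}" "m = \<rho> (F i) *v v" by auto
  then have "i \<in> {1..5} \<or> i = 6" by auto
  then show ?thesis using F_v[of i] i(2) f_def by auto
qed

lemma height_16: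
  assumes "\<rho> height *v x = 16 *s x"
  obtains c where "x = c *s v"
proof -
  have "x \<in> vec.span {m \<in> (\<Union>k. D k). \<rho> height *v m = 16 *s m}"
    using height_D assms by (intro eigenvector_in_span_eigenvectors[OF span_D]) blast+
  moreover have "m \<in> {v, 0}" if "m \<in> D k" "\<rho> height *v m = 16 *s m" for m k
  proof -
    have "(16 - 2 * of_nat k) *s m = 16 *s m" using height_D[OF that(1)] that(2) by simp
    then have "k = 0 \<or> m = 0" by (auto simp: )
    then show ?thesis using that(1) by auto
  qed
  then have "{m \<in> (\<Union>k. D k). \<rho> height *v m = 16 *s m} \<subseteq> {v, 0}" by blast
  ultimately have "x \<in> vec.span {v, 0}" using vec.span_mono by blast
  then show thesis using that by (auto simp: vec.span_insert)
qed

section \<open>The two top levels of the height grading on the tensor square\<close>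

abbreviation "\<rho>2 \<equiv> tensor_rep \<rho> \<rho>"

lemma rep2: "lie_representation br \<rho>2"
  by (rule lie_representation_tensor_rep[OF rep rep])

lemma height_pure_D:
  assumes "s \<in> D k" "t \<in> D l"
  shows "\<rho>2 height *v pure s t = (32 - 2 * of_nat (k + l)) *s pure s t"
  unfolding tensor_rep_pure height_D[OF assms(1)] height_D[OF assms(2)] pure_simps
  by (simp only: vector_sadd_rdistrib[symmetric]) (simp add: algebra_simps)

text \<open>Depths add up in a pure tensor, so height 32 - 2n selects total depth \<open>n\<close>;
  only zero tensors satisfy the eigenvalue equation at a wrong depth.\<close>

lemma height_tensor_span:
  assumes x: "\<rho>2 height *v x = (32 - 2 * of_nat n) *s x"
  shows "x \<in> vec.span ({pure s t | s t k l. s \<in> D k \<and> t \<in> D l \<and> k + l = n} \<union> {0})"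
proof -
  let ?S = "{pure s t | s t. s \<in> (\<Union>k. D k) \<and> t \<in> (\<Union>k. D k)}"
  have "x \<in> vec.span {m \<in> ?S. \<rho>2 height *v m = (32 - 2 * of_nat n) *s m}"
    using height_pure_D x by (intro eigenvector_in_span_eigenvectors[OF span_pure[OF span_D]]) blast+
  moreover have "pure s t = 0 \<or> k + l = n"
    if "s \<in> D k" "t \<in> D l" "\<rho>2 height *v pure s t = (32 - 2 * of_nat n) *s pure s t" for s t k l
  proof -
    have "(32 - 2 * of_nat (k + l)) *s pure s t = (32 - 2 * of_nat n) *s pure s t"
      by (rule trans[OF height_pure_D[OF that(1,2), symmetric] that(3)])
    then have "32 - 2 * of_nat (k + l) = 32 - 2 * (of_nat n :: complex) \<or> pure s t = 0"
      by (simp only: vector_mul_rcancel)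
    then have "of_nat (k + l) = (of_nat n :: complex) \<or> pure s t = 0" by (simp del: of_nat_add)
    then show ?thesis by (simp only: of_nat_eq_iff) auto
  qed
  then have "{m \<in> ?S. \<rho>2 height *v m = (32 - 2 * of_nat n) *s m}
      \<subseteq> {pure s t | s t k l. s \<in> D k \<and> t \<in> D l \<and> k + l = n} \<union> {0}" by blast
  ultimately show ?thesis using vec.span_mono by blast
qed

lemma height_32:
  assumes "\<rho>2 height *v x = 32 *s x"
  obtains c where "x = c *s pure v v"
proof -
  let ?P = "{pure s t | s t k l. s \<in> D k \<and> t \<in> D l \<and> k + l = 0} \<union> {0}"
  have "x \<in> vec.span ?P" using assms by (intro height_tensor_span) simp
  moreover have "?P \<subseteq> {pure v v, 0}" by auto
  ultimately have "x \<in> vec.span {pure v v, 0}" using vec.span_mono by blast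
  then show thesis using that by (auto simp: vec.span_insert)
qed

text \<open>At depth 1 only v \<otimes> f and f \<otimes> v remain, and \<open>E 6\<close> sends
  both to v \<otimes> v. Its kernel is therefore the antisymmetric line, which forces the sign of
  the flip on W.\<close>

lemma height_30:
  assumes h: "\<rho>2 height *v x = 30 *s x" and E: "\<rho>2 (E 6) *v x = 0"
  obtains c where "x = c *s (pure v f - pure f v)"
proof -
  have "x \<in> vec.span ({pure s t | s t k l. s \<in> D k \<and> t \<in> D l \<and> k + l = 1} \<union> {0})"
    using h by (intro height_tensor_span) simp
  moreover have "pure s t \<in> {pure v f, pure f v, 0}" if "s \<in> D k" "t \<in> D l" "k + l = 1" for s t k l
  proof -
    have "k = 0 \<and> l = 1 \<or> k = 1 \<and> l = 0" using that(3) by auto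
    then show ?thesis using that(1,2) D_1[of s] D_1[of t] by (auto simp: pure_simps simp del: descendants.simps(2) One_nat_def)
  qed
  then have "{pure s t | s t k l. s \<in> D k \<and> t \<in> D l \<and> k + l = 1} \<union> {0} \<subseteq> {pure v f, pure f v, 0}" by blast
  ultimately have "x \<in> vec.span {pure v f, pure f v, 0}" using vec.span_mono by blast
  then obtain a b where "x - a *s pure v f - b *s pure f v = 0" by (auto simp: vec.span_insert)
  then have x: "x = a *s pure v f + b *s pure f v" by (simp add: algebra_simps)
  have "\<rho>2 (E 6) *v x = (a + b) *s pure v v"
    unfolding x by (simp add: matrix_vector_right_distrib vec.scale tensor_rep_pure E6_f Ev pure_simps vector_sadd_rdistrib)
  then have "(a + b) *s pure v v = 0" using E by simp
  then have "a + b = 0" using v0 by (simp only: vector_mul_eq_0 pure_eq_0_iff) simp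
  then have "b = - a" by (simp add: add_eq_0_iff)
  then have "x = a *s (pure v f - pure f v)" unfolding x by (simp add: vector_ssub_ldistrib vector_smult_lneg)
  then show thesis by (rule that)
qed

end

subsection \<open>Decompositions into three summands\<close>

lemma direct_sum3_projections:
  fixes A B C :: "(complex ^ 'm::finite) set"
  assumes ds: "internal_direct_sum3 A B C"
    and sub: "vec.subspace A" "vec.subspace B" "vec.subspace C"
  obtains P Q R :: "complex ^ 'm ^ 'm" where "P + Q + R = mat 1"
    "\<And>x. P *v x \<in> A" "\<And>x. Q *v x \<in> B" "\<And>x. R *v x \<in> C"
    "\<And>x. x \<in> A \<Longrightarrow> P *v x = x \<and> Q *v x = 0 \<and> R *v x = 0"
    "\<And>x. x \<in> B \<Longrightarrow> P *v x = 0 \<and> Q *v x = x \<and> R *v x = 0"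
    "\<And>x. x \<in> C \<Longrightarrow> P *v x = 0 \<and> Q *v x = 0 \<and> R *v x = x"
proof -
  have ex: "\<exists>!(a, b, c). a \<in> A \<and> b \<in> B \<and> c \<in> C \<and> x = a + b + c" for x
    using ds unfolding internal_direct_sum3_def by blast
  then have "\<forall>x. \<exists>a b c. a \<in> A \<and> b \<in> B \<and> c \<in> C \<and> x = a + b + c" by fast
  then obtain p q r where pqr: "\<And>x. p x \<in> A" "\<And>x. q x \<in> B" "\<And>x. r x \<in> C" "\<And>x. x = p x + q x + r x"
    by metis
  have uniq: "p x = a \<and> q x = b \<and> r x = c" if "a \<in> A" "b \<in> B" "c \<in> C" "x = a + b + c" for x a b c
    using ex[of x] pqr[of x] that by blast
  have add: "p (x + y) = p x + p y \<and> q (x + y) = q x + q y \<and> r (x + y) = r x + r y" for x y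
  proof (rule uniq)
    show "x + y = p x + p y + (q x + q y) + (r x + r y)"
      by (subst pqr(4)[of x], subst pqr(4)[of y]) (simp add: add_ac)
  qed (intro vec.subspace_add sub pqr)+
  have scale: "p (c *s x) = c *s p x \<and> q (c *s x) = c *s q x \<and> r (c *s x) = c *s r x" for c x
  proof (rule uniq)
    show "c *s x = c *s p x + c *s q x + c *s r x"
      by (subst pqr(4)[of x]) (simp add: vector_add_ldistrib)
  qed (intro vec.subspace_scale sub pqr)+
  have lin: "Vector_Spaces.linear (*s) (*s) p" "Vector_Spaces.linear (*s) (*s) q" "Vector_Spaces.linear (*s) (*s) r"
    using add scale by (auto intro!: Vector_Spaces.linear_iff[THEN iffD2] simp: vec.vector_space_axioms)
  note m = matrix_works[OF lin(1)] matrix_works[OF lin(2)] matrix_works[OF lin(3)]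
  note z = vec.subspace_0[OF sub(1)] vec.subspace_0[OF sub(2)] vec.subspace_0[OF sub(3)]
  show thesis
  proof (rule that[of "matrix p" "matrix q" "matrix r"])
    show "matrix p + matrix q + matrix r = mat 1"
      using pqr(4) by (simp add: matrix_eq matrix_vector_mult_add_rdistrib m flip: pqr(4))
  next
    fix x assume "x \<in> A" then show "matrix p *v x = x \<and> matrix q *v x = 0 \<and> matrix r *v x = 0"
      using uniq[of x 0 0 x] z by (simp add: m)
  next
    fix x assume "x \<in> B" then show "matrix p *v x = 0 \<and> matrix q *v x = x \<and> matrix r *v x = 0"
      using uniq[of 0 x 0 x] z by (simp add: m)
  next
    fix x assume "x \<in> C" then show "matrix p *v x = 0 \<and> matrix q *v x = 0 \<and> matrix r *v x = x"
      using uniq[of 0 0 x x] z by (simp add: m)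
  qed (simp_all add: m pqr)
qed

lemma projection_eqI:
  assumes "\<And>x. x \<in> Y \<Longrightarrow> P *v x = x" "\<And>x. x \<in> Z \<Longrightarrow> P *v x = 0"
    and "\<And>x. \<exists>y\<in>Y. \<exists>z\<in>Z. x = y + z"
  shows "projection Y Z = P"
  unfolding projection_def
proof (rule the_equality)
  fix Q assume Q: "(\<forall>v\<in>Y. Q *v v = v) \<and> (\<forall>v\<in>Z. Q *v v = 0)"
  show "Q = P"
    unfolding matrix_eq
  proof
    fix x
    obtain y z where "y \<in> Y" "z \<in> Z" "x = y + z" using assms(3) by blast
    then show "Q *v x = P *v x" using Q assms(1,2) by (simp add: matrix_vector_right_distrib)
  qed
qed (use assms in auto)

text \<open>Schur's lemma for two different irreducible modules. If \<open>M\<close> were nonzero on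
  \<open>X\<close>, it would be an isomorphism, and the preimage of \<open>y\<close> would satisfy
  all eigenvalue equations of \<open>y\<close>; \<open>key\<close> expresses that \<open>X\<close>
  has no such nonzero vector.\<close>

lemma irreducible_hom_zero:
  assumes rep: "lie_representation br \<sigma>" and X: "irreducible_submodule \<sigma> X" and Y: "irreducible_submodule \<sigma> Y"
    and M: "\<And>a. M ** \<sigma> a = \<sigma> a ** M" "\<And>x. x \<in> X \<Longrightarrow> M *v x \<in> Y"
    and y: "y \<in> Y" "y \<noteq> 0"
    and key: "\<And>z. z \<in> X \<Longrightarrow> (\<And>a c. \<sigma> a *v y = c *s y \<Longrightarrow> \<sigma> a *v z = c *s z) \<Longrightarrow> z = 0"
    and x: "x \<in> X"
  shows "M *v x = 0"
proof -
  have sX: "submodule \<sigma> X" and sY: "submodule \<sigma> Y" using X Y by (auto simp: irreducible_submodule_def)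
  then have X0: "vec.subspace X" "\<And>a x. x \<in> X \<Longrightarrow> \<sigma> a *v x \<in> X" by (auto simp: submodule_def)
  have Mv: "M *v (\<sigma> a *v x) = \<sigma> a *v (M *v x)" for a x
    by (simp add: matrix_vector_mul_assoc M(1))
  let ?R = "{x \<in> X. M *v x = 0}"
  have "submodule \<sigma> ?R"
    using sX unfolding submodule_def vec.subspace_def
    by (auto simp: Mv matrix_vector_right_distrib vec.scale)
  then have "?R = {0} \<or> ?R = X" using X unfolding irreducible_submodule_def by blast
  moreover have False if R: "?R = {0}" "M *v x \<noteq> 0"
  proof -
    have "submodule \<sigma> ((*v) M ` X)"
      unfolding submodule_def
    proof (intro conjI allI ballI)
      show "vec.subspace ((*v) M ` X)"
        by (rule vec.linear_subspace_image[OF matrix_vector_mul_linear_gen X0(1)])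
      show "\<sigma> a *v w \<in> (*v) M ` X" if "w \<in> (*v) M ` X" for a w
        using that X0(2) by (auto simp flip: Mv)
    qed
    then have "(*v) M ` X = {0} \<or> (*v) M ` X = Y"
      using Y M(2) unfolding irreducible_submodule_def by blast
    then obtain z where z: "z \<in> X" "M *v z = y" using x R(2) y(1) by blast
    have "\<sigma> a *v z = c *s z" if "\<sigma> a *v y = c *s y" for a c
    proof -
      have "M *v (\<sigma> a *v z - c *s z) = 0"
        using that by (simp add: matrix_vector_mult_diff_distrib vec.scale Mv z(2))
      moreover have "\<sigma> a *v z - c *s z \<in> X"
        using z(1) X0 by (intro vec.subspace_diff vec.subspace_scale) auto
      ultimately have "\<sigma> a *v z - c *s z \<in> ?R" by blast
      then show ?thesis unfolding R(1) by simp
    qed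
    then have "z = 0" using key z(1) by blast
    then show False using z(2) y(2) by simp
  qed
  ultimately show ?thesis using x by blast
qed

lemma flip_tensor_rep: "flip ** tensor_rep \<rho> \<rho> x = tensor_rep \<rho> \<rho> x ** flip"
  unfolding tensor_rep_def matrix_add_ldistrib matrix_add_rdistrib_mult flip_kronecker by (rule add.commute)

section \<open>Scalars of the flip and of Omega on the three summands\<close>

locale e6_square = e6_minuscule br E F H \<rho> v + killing_dual_bases br xs ys
  for br :: "'d::finite bracket" and E F H :: "nat \<Rightarrow> complex ^ 'd"
    and \<rho> :: "complex ^ 'd \<Rightarrow> complex ^ 'n ^ 'n::finite" and v :: "complex ^ 'n"
    and xs ys :: "'d \<Rightarrow> complex ^ 'd" +
  fixes U X W :: "(complex ^ ('n \<times> 'n)) set" and PU PX PW :: "complex ^ ('n \<times> 'n) ^ ('n \<times> 'n)"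
    and u w :: "complex ^ ('n \<times> 'n)"
  assumes dim: "CARD('n) = 27"
    and sum_P: "PU + PX + PW = mat 1"
    and range_P: "\<And>x. PU *v x \<in> U" "\<And>x. PX *v x \<in> X" "\<And>x. PW *v x \<in> W"
    and P_U: "\<And>x. x \<in> U \<Longrightarrow> PU *v x = x \<and> PX *v x = 0 \<and> PW *v x = 0"
    and P_X: "\<And>x. x \<in> X \<Longrightarrow> PU *v x = 0 \<and> PX *v x = x \<and> PW *v x = 0"
    and P_W: "\<And>x. x \<in> W \<Longrightarrow> PU *v x = 0 \<and> PX *v x = 0 \<and> PW *v x = x"
    and irr_U: "irreducible_submodule (tensor_rep \<rho> \<rho>) U"
    and irr_X: "irreducible_submodule (tensor_rep \<rho> \<rho>) X"
    and irr_W: "irreducible_submodule (tensor_rep \<rho> \<rho>) W"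
    and dual_X: "isomorphic_to_submodule (dual_rep \<rho>) (tensor_rep \<rho> \<rho>) X"
    and u: "u \<in> U" "u \<noteq> 0" "tensor_rep \<rho> \<rho> height *v u = 32 *s u"
    and w: "w \<in> W" "w \<noteq> 0" "tensor_rep \<rho> \<rho> height *v w = 30 *s w" "tensor_rep \<rho> \<rho> (E 6) *v w = 0"
begin

text \<open>Operators of this kind are encoded by triples of scalars, multiplied componentwise, and
  their traces depend only on the triple and the three dimensions.\<close>

definition acts :: "complex ^ ('n \<times> 'n) ^ ('n \<times> 'n) \<Rightarrow> complex \<Rightarrow> complex \<Rightarrow> complex \<Rightarrow> bool" where
  "acts M a b c \<longleftrightarrow> (\<forall>x\<in>U. M *v x = a *s x) \<and> (\<forall>x\<in>X. M *v x = b *s x) \<and> (\<forall>x\<in>W. M *v x = c *s x)"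

lemma split: "x = PU *v x + PX *v x + PW *v x"
  using sum_P by (metis matrix_vector_mul_lid matrix_vector_mult_add_rdistrib)

lemma acts_eq:
  assumes "acts M a b c"
  shows "M = a *sm PU + b *sm PX + c *sm PW"
proof -
  have "M *v x = a *s (PU *v x) + b *s (PX *v x) + c *s (PW *v x)" for x
    using assms range_P unfolding acts_def
    by (subst split[of x]) (simp add: matrix_vector_right_distrib)
  then show ?thesis
    by (simp add: matrix_eq matrix_vector_mult_add_rdistrib smult_mat_mult_vec)
qed

lemma acts_mult:
  assumes "acts M a b c" "acts M' a' b' c'"
  shows "acts (M ** M') (a * a') (b * b') (c * c')"
  using assms unfolding acts_def
  by (simp add: matrix_vector_mul_assoc[symmetric] vec.scale vector_smult_assoc mult.commute)

lemma acts_mat_1: "acts (mat 1) 1 1 1"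
  by (simp add: acts_def)

lemma acts_smult: "acts M a b c \<Longrightarrow> acts (k *sm M) (k * a) (k * b) (k * c)"
  by (simp add: acts_def smult_mat_mult_vec vector_smult_assoc)

lemma acts_mat_power: "acts M a b c \<Longrightarrow> acts (mat_power M k) (a ^ k) (b ^ k) (c ^ k)"
  by (induction k) (auto intro: acts_mat_1 acts_mult)

lemma submodules: "submodule \<rho>2 U" "submodule \<rho>2 X" "submodule \<rho>2 W"
  using irr_U irr_X irr_W by (auto simp: irreducible_submodule_def)

lemma P_commute: "PU ** \<rho>2 a = \<rho>2 a ** PU" "PX ** \<rho>2 a = \<rho>2 a ** PX" "PW ** \<rho>2 a = \<rho>2 a ** PW"
proof -
  have "PU *v (\<rho>2 a *v x) = \<rho>2 a *v (PU *v x) \<and> PX *v (\<rho>2 a *v x) = \<rho>2 a *v (PX *v x)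
    \<and> PW *v (\<rho>2 a *v x) = \<rho>2 a *v (PW *v x)" for x
  proof -
    have "\<rho>2 a *v x = \<rho>2 a *v (PU *v x) + \<rho>2 a *v (PX *v x) + \<rho>2 a *v (PW *v x)"
      by (subst split[of x]) (simp add: matrix_vector_right_distrib)
    moreover have "\<rho>2 a *v (PU *v x) \<in> U" "\<rho>2 a *v (PX *v x) \<in> X" "\<rho>2 a *v (PW *v x) \<in> W"
      using submodules range_P unfolding submodule_def by blast+
    ultimately show ?thesis using P_U P_X P_W by (simp add: matrix_vector_right_distrib)
  qed
  then show "PU ** \<rho>2 a = \<rho>2 a ** PU" "PX ** \<rho>2 a = \<rho>2 a ** PX" "PW ** \<rho>2 a = \<rho>2 a ** PW"
    by (simp_all add: matrix_eq flip: matrix_vector_mul_assoc)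
qed

lemma u_eq: obtains c where "c \<noteq> 0" "u = c *s pure v v"
  using height_32[OF u(3)] u(2) by (metis vector_mul_eq_0)

lemma w_eq: obtains c where "c \<noteq> 0" "w = c *s (pure v f - pure f v)"
  using height_30[OF w(3,4)] w(2) by (metis vector_mul_eq_0)

lemma flip_U: "x \<in> U \<Longrightarrow> flip *v x = x"
proof -
  assume x: "x \<in> U"
  obtain c where "u = c *s pure v v" by (rule u_eq)
  then have "flip *v u = 1 *s u" by (simp add: vec.scale flip_pure)
  then show ?thesis
    using scalar_on_irreducible_submodule[OF irr_U flip_tensor_rep u(1,2) _ x, of 1] by simp
qed

lemma flip_W: "x \<in> W \<Longrightarrow> flip *v x = - x"
proof -
  assume x: "x \<in> W"
  obtain c where "w = c *s (pure v f - pure f v)" by (rule w_eq)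
  then have "flip *v w = (-1) *s w"
    by (simp add: vec.scale flip_pure matrix_vector_mult_diff_distrib vector_ssub_ldistrib)
  then show ?thesis
    using scalar_on_irreducible_submodule[OF irr_W flip_tensor_rep w(1,2) _ x, of "-1"] by simp
qed

text \<open>The U and W components of the flip on X are module maps and vanish, because X contains
  no copy of the highest weight lines of U and W. So the flip is an involution of X, and Schur's
  lemma gives a sign.\<close>

lemma flip_X:
  obtains e where "e = 1 \<or> e = -1" "\<And>x. x \<in> X \<Longrightarrow> flip *v x = e *s x"
proof -
  have comm: "(P ** flip) ** \<rho>2 a = \<rho>2 a ** (P ** flip)" if "P ** \<rho>2 a = \<rho>2 a ** P" for P a
    by (metis flip_tensor_rep matrix_mul_assoc that)
  have 1: "(PU ** flip) *v x = 0" if x: "x \<in> X" for x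
  proof (rule irreducible_hom_zero[OF rep2 irr_X irr_U comm[OF P_commute(1)] _ u(1,2) _ x])
    show "(PU ** flip) *v x \<in> U" for x
      using range_P by (simp flip: matrix_vector_mul_assoc)
    fix z assume z: "z \<in> X" and "\<And>a c. \<rho>2 a *v u = c *s u \<Longrightarrow> \<rho>2 a *v z = c *s z"
    then have "\<rho>2 height *v z = 32 *s z" using u(3) by blast
    then obtain c where c: "z = c *s pure v v" by (rule height_32)
    obtain c' where c': "c' \<noteq> 0" "u = c' *s pure v v" by (rule u_eq)
    \<comment> \<open>The height 32 space is a line, so \<open>z\<close> lies in both X and
      U.\<close>
    have "z = (c / c') *s u" using c c' by (simp add: vector_smult_assoc)
    then have "z \<in> U" using u(1) submodules(1) by (auto simp: submodule_def intro: vec.subspace_scale)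
    then show "z = 0" using P_U[of z] P_X[OF z] by metis
  qed
  have 2: "(PW ** flip) *v x = 0" if x: "x \<in> X" for x
  proof (rule irreducible_hom_zero[OF rep2 irr_X irr_W comm[OF P_commute(3)] _ w(1,2) _ x])
    show "(PW ** flip) *v x \<in> W" for x
      using range_P by (simp flip: matrix_vector_mul_assoc)
    fix z assume z: "z \<in> X" and k: "\<And>a c. \<rho>2 a *v w = c *s w \<Longrightarrow> \<rho>2 a *v z = c *s z"
    then have "\<rho>2 height *v z = 30 *s z" using w(3) by blast
    moreover have "\<rho>2 (E 6) *v z = 0" using k[of "E 6" 0] w(4) by simp
    ultimately obtain c where c: "z = c *s (pure v f - pure f v)" by (rule height_30)
    obtain c' where c': "c' \<noteq> 0" "w = c' *s (pure v f - pure f v)" by (rule w_eq)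
    have "z = (c / c') *s w" using c c' by (simp add: vector_smult_assoc)
    then have "z \<in> W" using w(1) submodules(3) by (auto simp: submodule_def intro: vec.subspace_scale)
    then show "z = 0" using P_W[of z] P_X[OF z] by metis
  qed
  have "flip *v x = PX *v (flip *v x)" if "x \<in> X" for x
    by (rule trans[OF split[of "flip *v x"]]) (simp add: matrix_vector_mul_assoc 1[OF that] 2[OF that])
  then have fX: "flip *v x \<in> X" if "x \<in> X" for x
    using range_P(2) that by metis
  have ff: "flip *v (flip *v x) = x" for x :: "complex ^ ('n \<times> 'n)"
    by (simp add: matrix_vector_mul_assoc flip_flip)
  have "X \<noteq> {0}" "0 \<in> X" using irr_X submodules(2)
    by (auto simp: irreducible_submodule_def submodule_def vec.subspace_0)
  then obtain z where z: "z \<in> X" "z \<noteq> 0" by blast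
  note sc = scalar_on_irreducible_submodule[OF irr_X flip_tensor_rep]
  show thesis
  \<comment> \<open>The symmetrisation of \<open>z\<close> is an eigenvector for 1, unless it
    vanishes and \<open>z\<close> itself is one for -1.\<close>
  proof (cases "z + flip *v z = 0")
    case True
    then have "flip *v z = (-1) *s z" by (simp add: add_eq_0_iff)
    from sc[OF z this] show thesis by (rule that[OF disjI2[OF refl]])
  next
    case False
    have "z + flip *v z \<in> X" using z(1) fX submodules(2) by (simp add: submodule_def vec.subspace_add)
    moreover have "flip *v (z + flip *v z) = 1 *s (z + flip *v z)"
      by (simp add: matrix_vector_right_distrib ff)
    ultimately have "flip *v x = 1 *s x" if "x \<in> X" for x by (rule sc[OF _ False _ that])
    then show thesis by (rule that[OF disjI1[OF refl]])
  qed
qed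

lemma trace_acts:
  assumes "acts M a b c"
  shows "trace M = a * trace PU + b * trace PX + c * trace PW"
  unfolding acts_eq[OF assms] by (simp add: trace_add trace_smult_mat)

lemma casimir_scalar: obtains C where "casimir \<rho> = C *sm mat 1"
proof -
  have "\<rho> height *v (casimir \<rho> *v v) = 16 *s (casimir \<rho> *v v)"
    by (metis casimir_commute[OF rep] height_v matrix_vector_mul_assoc vec.scale)
  then obtain C where C: "casimir \<rho> *v v = C *s v" by (rule height_16)
  have "casimir \<rho> *v x = C *s x" for x
    using scalar_on_irreducible_submodule[OF irr casimir_commute[OF rep] _ v0 C] by simp
  then have "casimir \<rho> = C *sm mat 1" by (simp add: matrix_eq smult_mat_mult_vec)
  then show thesis by (rule that)
qed

text \<open>\<open>Omega\<close> is half of the Casimir operator of the tensor square minus C, hence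
  it commutes with the action. The isomorphism with the dual transports the eigenvalue C to X, which
  leaves (C - 2C)/2.\<close>

lemma
  assumes C: "casimir \<rho> = C *sm mat 1"
  shows casimir_square: "casimir \<rho>2 = (2 * C) *sm mat 1 + 2 *sm Omega \<rho> xs ys"
    and Omega_commute: "Omega \<rho> xs ys ** \<rho>2 a = \<rho>2 a ** Omega \<rho> xs ys"
    and Omega_X: "x \<in> X \<Longrightarrow> Omega \<rho> xs ys *v x = (- C / 2) *s x"
proof -
  have "(C *sm mat 1) \<otimes>\<^sub>k mat 1 + mat 1 \<otimes>\<^sub>k (C *sm mat 1) = (2 * C) *sm (mat 1 :: complex ^ ('n \<times> 'n) ^ ('n \<times> 'n))"
    by (auto simp: vec_eq_iff kronecker_def mat_def)
  then show sq: "casimir \<rho>2 = (2 * C) *sm mat 1 + 2 *sm Omega \<rho> xs ys"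
    using casimir_tensor_rep[OF rep] C by simp
  then have O: "Omega \<rho> xs ys = (1/2) *sm casimir \<rho>2 - C *sm mat 1"
    by (simp add: vec_eq_iff field_simps)
  show "Omega \<rho> xs ys ** \<rho>2 a = \<rho>2 a ** Omega \<rho> xs ys"
    unfolding O matrix_mult_diff_left matrix_mult_diff_right smult_mat_mult_left smult_mat_mult_right
    by (simp add: casimir_commute[OF rep2])
  show "Omega \<rho> xs ys *v x = (- C / 2) *s x" if x: "x \<in> X"
  proof -
    obtain g where g: "Vector_Spaces.linear (*s) (*s) g" "bij_betw g UNIV X"
      "\<And>a y. g (dual_rep \<rho> a *v y) = \<rho>2 a *v g y"
      using dual_X unfolding isomorphic_to_submodule_def by blast
    obtain y where y: "x = g y" using g(2) x by (auto simp: bij_betw_def)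
    have "casimir \<rho>2 *v x = (\<Sum>a\<in>UNIV. \<rho>2 (xs a) *v (\<rho>2 (ys a) *v g y))"
      by (simp add: casimir_def matrix_vector_mult_sum_left matrix_vector_mul_assoc y)
    also have "\<dots> = g (casimir (dual_rep \<rho>) *v y)"
      by (simp add: casimir_def matrix_vector_mult_sum_left vec.linear_sum[OF g(1)] flip: g(3) matrix_vector_mul_assoc)
    also have "casimir (dual_rep \<rho>) = C *sm mat 1"
      unfolding casimir_dual_rep[OF rep] C by (auto simp: vec_eq_iff transpose_def mat_def)
    also have "g ((C *sm mat 1) *v y) = C *s x"
      by (simp add: smult_mat_mult_vec vec.linear_scale[OF g(1)] y)
    finally show ?thesis
      unfolding O by (simp add: matrix_vector_mult_diff_rdistrib smult_mat_mult_vec vector_smult_assoc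
          vector_sub_rdistrib[symmetric])
  qed
qed

text \<open>With \<open>A\<close> the embedding of the dual and \<open>B\<close> a left inverse, the
  projection is \<open>A ** (B ** PX)\<close>, while the product in the other order is the identity
  of a 27-dimensional space.\<close>

lemma trace_PX: "trace PX = 27"
proof -
  obtain g where g: "Vector_Spaces.linear (*s) (*s) g" "bij_betw g UNIV X"
    "\<And>a y. g (dual_rep \<rho> a *v y) = \<rho>2 a *v g y"
    using dual_X unfolding isomorphic_to_submodule_def by blast
  define A where "A = matrix g"
  have A: "A *v y = g y" for y unfolding A_def by (rule matrix_works[OF g(1)])
  have "inj ((*v) A)" using g(2) by (simp add: A bij_betw_def inj_on_def)
  then obtain B where B: "B ** A = mat 1" using matrix_left_invertible_injective by blast
  have BA: "B *v (A *v y) = y" for y by (simp add: matrix_vector_mul_assoc B)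
  have "PX *v (A *v y) = A *v y" for y
    using P_X g(2) by (auto simp: A bij_betw_def)
  then have 1: "(B ** PX) ** A = mat 1" by (simp add: matrix_eq BA flip: matrix_vector_mul_assoc)
  have "A *v (B *v (PX *v x)) = PX *v x" for x
  proof -
    obtain y where "PX *v x = A *v y" using range_P(2)[of x] g(2) by (auto simp: A bij_betw_def)
    then show ?thesis by (simp add: BA)
  qed
  then have "A ** (B ** PX) = PX" by (simp add: matrix_eq flip: matrix_vector_mul_assoc)
  then have "trace PX = trace ((B ** PX) ** A)" by (metis trace_mul_sym)
  then show ?thesis by (simp add: 1 trace_I dim)
qed

text \<open>\<open>Omega\<close> commutes with the action and so preserves the lines of
  \<open>u\<close> and \<open>w\<close>, which are cut out by eigenvalue equations; Schur's lemma
  spreads the two scalars over U and W.\<close>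

lemma acts_Omega:
  assumes C: "casimir \<rho> = C *sm mat 1"
  obtains a c where "acts (Omega \<rho> xs ys) a (- C / 2) c"
proof -
  let ?O = "Omega \<rho> xs ys"
  have pres: "\<rho>2 x *v (?O *v y) = c *s (?O *v y)" if "\<rho>2 x *v y = c *s y" for x y c
    by (metis Omega_commute[OF C] matrix_vector_mul_assoc vec.scale that)
  obtain k where k: "?O *v u = k *s pure v v" using height_32[OF pres[OF u(3)]] by blast
  obtain k' where k': "k' \<noteq> 0" "u = k' *s pure v v" by (rule u_eq)
  have ku: "?O *v u = (k / k') *s u" using k k' by (simp add: vector_smult_assoc)
  have "\<rho>2 (E 6) *v (?O *v w) = 0" using pres[of "E 6" w 0] w(4) by simp
  then obtain l where l: "?O *v w = l *s (pure v f - pure f v)"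
    using height_30[OF pres[OF w(3)]] by blast
  obtain l' where l': "l' \<noteq> 0" "w = l' *s (pure v f - pure f v)" by (rule w_eq)
  have lw: "?O *v w = (l / l') *s w" using l l' by (simp add: vector_smult_assoc)
  note sc = scalar_on_irreducible_submodule[OF _ Omega_commute[OF C]]
  have "acts ?O (k / k') (- C / 2) (l / l')"
    unfolding acts_def using sc[OF irr_U u(1,2) ku] sc[OF irr_W w(1,2) lw] Omega_X[OF C] by blast
  then show thesis by (rule that)
qed

lemma rho_nonzero: "\<rho> height \<noteq> 0"
  using height_v v0 by auto

text \<open>The trace of \<open>\<Omega>\<^sup>2\<close> is needed only to exclude that the flip is \<open>-1\<close> on the dual summand, which would
  force the Lie algebra to have dimension 504/5.\<close>

theorem acts_flip_Omega: "acts flip 1 1 (-1)" "acts (Omega \<rho> xs ys) (1/18) (-13/36) (-1/36)"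
proof -
  let ?O = "Omega \<rho> xs ys"
  obtain C where C: "casimir \<rho> = C *sm mat 1" by (rule casimir_scalar)
  obtain a c where O: "acts ?O a (- C / 2) c" by (rule acts_Omega[OF C])
  obtain e where e: "e = 1 \<or> e = -1" "\<And>x. x \<in> X \<Longrightarrow> flip *v x = e *s x" by (rule flip_X) blast
  have fl: "acts flip 1 e (-1)"
    unfolding acts_def using flip_U flip_W e(2) by simp
  \<comment> \<open>These are the unknown dimensions of U and W.\<close>
  define tU tW where "tU = trace PU" and "tW = trace PW"
  have tr: "trace M = \<alpha> * tU + \<beta> * 27 + \<gamma> * tW" if "acts M \<alpha> \<beta> \<gamma>" for M \<alpha> \<beta> \<gamma>
    unfolding trace_acts[OF that] trace_PX tU_def tW_def ..
  have tC: "trace (casimir \<rho>) = 27 * C" unfolding C by (simp add: trace_smult_mat trace_I dim)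
  have card: "CARD('n \<times> 'n) = 729" by (simp add: dim)
  have "trace (mat 1 :: complex ^ ('n \<times> 'n) ^ ('n \<times> 'n)) = 729"
    by (subst trace_I) (simp only: card of_nat_numeral)
  then have t1: "tU + 27 + tW = 729" using tr[OF acts_mat_1] by simp
  have t2: "tU + 27 * e - tW = 27" using tr[OF fl] trace_flip[where 'n = 'n] by (simp add: dim mult.commute)
  have t3: "a * tU - 27 * C / 2 + c * tW = 0"
    using tr[OF O] trace_Omega[of \<rho>, OF trace_rep_zero[OF rep]] by (simp add: mult.commute)
  have t4: "a * tU - 27 * e * C / 2 - c * tW = 27 * C"
    using tr[OF acts_mult[OF fl O]] trace_flip_Omega[of \<rho>] tC by simp
  have t5: "a\<^sup>2 * tU + 27 * e * (C / 2)\<^sup>2 - c\<^sup>2 * tW = (C - 1/2) * (27 * C)"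
    using tr[OF acts_mult[OF fl acts_mult[OF O O]]] trace_flip_Omega_square[OF rep C] tC
    by (simp add: power2_eq_square)
  obtain k where k: "\<And>x y. trace (\<rho> x ** \<rho> y) = k * killing br x y"
    using trace_form_eq_killing[OF rep simple] by blast
  have t6: "a\<^sup>2 * tU + 27 * (C / 2)\<^sup>2 + c\<^sup>2 * tW = k\<^sup>2 * of_nat CARD('d)"
    using tr[OF acts_mult[OF O O]] trace_Omega_square[OF k] by (simp add: power2_eq_square)
  have t7: "k * of_nat CARD('d) = 27 * C" using trace_casimir[OF k] tC by simp
  have O0: "a \<noteq> 0 \<or> C \<noteq> 0 \<or> c \<noteq> 0"
    using acts_eq[OF O] Omega_nonzero[OF rep simple rho_nonzero] by (auto simp: vec_eq_iff)
  have e1: "e = 1"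
  proof (rule ccontr)
    assume "e \<noteq> 1"
    then have e: "e = -1" using e(1) by simp
    have tU: "tU = 378" and tW: "tW = 324" using t1 t2 e by (auto simp: algebra_simps)
    \<comment> \<open>Adding \<open>t3\<close> and \<open>t4\<close> gives 756 a = 27 C, that is a =
      C/28; subtracting them gives c = 0.\<close>
    define m where "m = C / 28"
    have Cm: "C = 28 * m" by (simp add: m_def)
    have "756 * a = 756 * m"
      using arg_cong2[where f = "(+)", OF t3 t4] unfolding tU tW e Cm by (simp add: algebra_simps)
    then have a: "a = m" by simp
    have "648 * c = 0"
      using arg_cong2[where f = "(-)", OF t3 t4] unfolding tU tW e Cm by (simp add: algebra_simps)
    then have c: "c = 0" by simp
    have "m \<noteq> 0" using O0 a c Cm by auto
    have "5670 * m\<^sup>2 = k\<^sup>2 * of_nat CARD('d)" using t6 unfolding tU tW a c Cm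
      by (simp add: power2_eq_square)
    moreover have "k * of_nat CARD('d) = 756 * m" using t7 Cm by simp
    \<comment> \<open>Eliminate \<open>k\<close> by squaring \<open>t7\<close>; 571536 is 756
      squared.\<close>
    ultimately have "m\<^sup>2 * (5670 * of_nat CARD('d)) = m\<^sup>2 * 571536" by algebra
    then have "(5670 * of_nat CARD('d) :: complex) = 571536" using \<open>m \<noteq> 0\<close> by simp
    then have "of_nat (5670 * CARD('d)) = (of_nat 571536 :: complex)" by simp
    then have "5670 * CARD('d) = 571536" by (simp only: of_nat_eq_iff)
    then have "5 * CARD('d) = 504" by simp
    then have "5 dvd (504 :: nat)" by (rule dvdI[OF sym])
    then show False by simp
  qed
  show "acts flip 1 1 (-1)" using fl e1 by simp
  have tU: "tU = 351" and tW: "tW = 351" using t1 t2 e1 by (auto simp: algebra_simps)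
  \<comment> \<open>Now the sum and the difference of \<open>t3\<close> and \<open>t4\<close> give
    702 a = 54 C and 702 c = -27 C.\<close>
  define m where "m = C / 26"
  have Cm: "C = 26 * m" by (simp add: m_def)
  have "702 * a = 702 * (2 * m)"
    using arg_cong2[where f = "(+)", OF t3 t4] unfolding tU tW e1 Cm by (simp add: algebra_simps)
  then have a: "a = 2 * m" by simp
  have "702 * c = 702 * (- m)"
    using arg_cong2[where f = "(-)", OF t3 t4] unfolding tU tW e1 Cm by (simp add: algebra_simps)
  then have c: "c = - m" by simp
  have "m \<noteq> 0" using O0 a c Cm by auto
  \<comment> \<open>Collected, \<open>t5\<close> reads 12636 m^2 = 351 m.\<close>
  have "m * (36 * m) = m * 1" using t5 unfolding tU tW e1 a c Cm by (simp add: algebra_simps power2_eq_square)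
  then have m: "m = 1 / 36" using \<open>m \<noteq> 0\<close> by (simp add: field_simps)
  show "acts ?O (1/18) (-13/36) (-1/36)" using O by (simp add: a c Cm m)
qed

end

subsection \<open>The exponential of the chord\<close>

text \<open>The power c^k starts in degree at least k, so each coefficient of the partial sums is
  eventually constant.\<close>

lemma fps_compose_sums:
  fixes a c :: "complex fps"
  assumes c: "fps_nth c 0 = 0"
  shows "(\<lambda>k. fps_const (fps_nth a k) * c ^ k) sums (a oo c)"
  unfolding sums_def
proof (rule tendsto_fpsI)
  fix n
  show "\<forall>\<^sub>F N in sequentially. fps_nth (\<Sum>k<N. fps_const (fps_nth a k) * c ^ k) n = fps_nth (a oo c) n"
    using eventually_gt_at_top[of n]
  proof eventually_elim
    case (elim N)
    have "(\<Sum>k<N. fps_nth a k * fps_nth (c ^ k) n) = (\<Sum>k=0..n. fps_nth a k * fps_nth (c ^ k) n)"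
      using elim by (intro sum.mono_neutral_right) (auto simp: startsby_zero_power_prefix[OF c])
    then show ?case by (simp add: fps_sum_nth fps_compose_nth)
  qed
qed

lemma matrix_sums:
  assumes "\<And>i j. (\<lambda>k. A k $ i $ j) sums (B $ i $ j)"
  shows "A sums (B :: complex fps ^ 'm ^ 'n)"
  using assms unfolding sums_def by (intro vec_tendstoI) simp

lemma fps_const_sum: "fps_const (\<Sum>i\<in>S. f i) = (\<Sum>i\<in>S. fps_const (f i :: complex))"
  by (induction S rule: infinite_finite_induct) (simp_all flip: fps_const_add)

lemma map_matrix_fps_const_mult:
  "map_matrix fps_const A ** map_matrix fps_const B = map_matrix fps_const (A ** (B :: complex ^ 'm ^ 'n))"
  by (simp add: vec_eq_iff matrix_matrix_mult_def fps_const_sum)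

lemma map_matrix_fps_const_mat_1: "map_matrix fps_const (mat 1) = (mat 1 :: complex fps ^ 'n ^ 'n)"
  by (simp add: vec_eq_iff mat_def)

lemma mat_power_smult_fps_const:
  "mat_power (g *sm map_matrix fps_const M) k = (g ^ k) *sm map_matrix fps_const (mat_power (M :: complex ^ 'n ^ 'n) k)"
proof (induction k)
  case 0
  then show ?case by (simp add: map_matrix_fps_const_mat_1) (simp add: vec_eq_iff)
next
  case (Suc k)
  then show ?case
    by (simp add: smult_mat_mult_left smult_mat_mult_right map_matrix_fps_const_mult) (simp add: vec_eq_iff)
qed

text \<open>Every entry of the exponential series is a combination of three exponential series
  evaluated at \<open>g\<close>.\<close>

lemma mat_exp_eq_projections:
  fixes M P Q R :: "complex ^ 'n ^ 'n"
  assumes g: "fps_nth g 0 = 0"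
    and pow: "\<And>k. mat_power M k = a ^ k *sm P + b ^ k *sm Q + c ^ k *sm R"
  shows "mat_exp (g *sm map_matrix fps_const M) =
    (fps_exp a oo g) *sm map_matrix fps_const P + (fps_exp b oo g) *sm map_matrix fps_const Q
    + (fps_exp c oo g) *sm map_matrix fps_const R"
proof -
  let ?A = "g *sm map_matrix fps_const M"
  have "(\<lambda>k. (fps_const (1 / fact k) *sm mat_power ?A k) $ i $ j) sums
     (((fps_exp a oo g) *sm map_matrix fps_const P + (fps_exp b oo g) *sm map_matrix fps_const Q
    + (fps_exp c oo g) *sm map_matrix fps_const R) $ i $ j)" for i j
  proof -
    \<comment> \<open>Collecting the entry in one series leaves a single composition whose
      convergence has to be checked.\<close>
    define s where "s = fps_exp a * fps_const (P $ i $ j) + fps_exp b * fps_const (Q $ i $ j) + fps_exp c * fps_const (R $ i $ j)"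
    have "(\<lambda>k. fps_const (fps_nth s k) * g ^ k) sums (s oo g)"
      by (rule fps_compose_sums[OF g])
    moreover have "fps_const (fps_nth s k) * g ^ k = (fps_const (1 / fact k) *sm mat_power ?A k) $ i $ j" for k
    proof -
      have "fps_nth s k = (1 / fact k) * (a ^ k * P $ i $ j + b ^ k * Q $ i $ j + c ^ k * R $ i $ j)"
        by (simp add: s_def add_divide_distrib)
      then have "fps_const (fps_nth s k) * g ^ k
          = fps_const (1 / fact k) * (g ^ k * fps_const (a ^ k * P $ i $ j + b ^ k * Q $ i $ j + c ^ k * R $ i $ j))"
        by (simp only: fps_const_mult[symmetric] ac_simps)
      then show ?thesis unfolding mat_power_smult_fps_const pow by simp
    qed
    moreover have "s oo g = ((fps_exp a oo g) *sm map_matrix fps_const P + (fps_exp b oo g) *sm map_matrix fps_const Q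
       + (fps_exp c oo g) *sm map_matrix fps_const R) $ i $ j"
      unfolding s_def by (simp add: fps_compose_add_distrib fps_compose_mult_distrib[OF g])
    ultimately show ?thesis by simp
  qed
  then show ?thesis unfolding mat_exp_def by (intro sums_unique[symmetric] matrix_sums)
qed

lemma fps_exp_compose_power:
  "fps_exp (of_nat n * c) oo fps_X ^ 2 = (fps_exp c oo fps_X ^ 2 :: complex fps) ^ n"
  by (subst fps_compose_power) (simp_all add: fps_exp_power_mult)

theorem mainTheorem4:
  fixes br :: "'d::finite bracket"
    and E F H :: "nat \<Rightarrow> complex ^ 'd"
    and \<rho> :: "complex ^ 'd \<Rightarrow> complex ^ 'n ^ 'n::finite"
    and U Vstar W :: "(complex ^ ('n \<times> 'n)) set"
    and xs ys :: "'d \<Rightarrow> complex ^ 'd"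
    and h :: complex
    and r s :: "complex fps"
    and I :: "'tangle \<Rightarrow> complex fps ^ ('n \<times> 'n) ^ ('n \<times> 'n)"
    and X_plus Id_strands H_solid H_do :: 'tangle
    and q :: "complex fls"
  assumes e6: "e6_lie_algebra br E F H"
    and V_rep: "lie_representation br \<rho>"
    and V_dim: "CARD('n) = 27"
    and V_weight: "irreducible_of_weight E H \<rho> UNIV [0, 0, 0, 0, 0, 1]"
    and decomposition: "internal_direct_sum3 U Vstar W"
    and U_weight: "irreducible_of_weight E H (tensor_rep \<rho> \<rho>) U [0, 0, 0, 0, 0, 2]"
    and Vstar_weight: "irreducible_of_weight E H (tensor_rep \<rho> \<rho>) Vstar [1, 0, 0, 0, 0, 0]"
    and Vstar_dual: "isomorphic_to_submodule (dual_rep \<rho>) (tensor_rep \<rho> \<rho>) Vstar"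
    and W_weight: "irreducible_of_weight E H (tensor_rep \<rho> \<rho>) W [0, 0, 0, 0, 1, 0]"
    and dual: "dual_bases br xs ys"
    and h_nonzero: "h \<noteq> 0"
    and I_X_plus: "I X_plus = flip ** mat_exp (fps_const (- 1 / 2) *sm Theta h \<rho> xs ys)"
    and I_Id: "I Id_strands = mat 1"
    and I_H: "I H_solid = r *sm map_matrix fps_const (projection Vstar (subspace_sum U W))"
    and I_H_do: "I H_do = s *sm map_matrix fps_const (projection U (subspace_sum Vstar W))"
    and r_nonzero: "r \<noteq> 0"
    and s_nonzero: "s \<noteq> 0"
    and q: "q = fps_to_fls (q_series h)"
  shows
    "map_matrix fps_to_fls (I X_plus) =
       (- (q powi -1)) *sm map_matrix fps_to_fls (I Id_strands)
       + ((q powi -1 + q powi -13) / fps_to_fls r) *sm map_matrix fps_to_fls (I H_solid)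
       + ((q powi -1 + q powi 2) / fps_to_fls s) *sm map_matrix fps_to_fls (I H_do)"
proof -
  have irr: "irreducible_submodule (tensor_rep \<rho> \<rho>) U" "irreducible_submodule (tensor_rep \<rho> \<rho>) Vstar"
    "irreducible_submodule (tensor_rep \<rho> \<rho>) W" "irreducible_submodule \<rho> UNIV"
    using U_weight Vstar_weight W_weight V_weight by (auto simp: irreducible_of_weight_def)
  then have sub: "vec.subspace U" "vec.subspace Vstar" "vec.subspace W"
    by (auto simp: irreducible_submodule_def submodule_def)
  interpret g: e6 br E F H by unfold_locales (rule e6)
  have rep2: "lie_representation br (tensor_rep \<rho> \<rho>)" by (rule lie_representation_tensor_rep[OF V_rep V_rep])
  obtain v where v: "v \<noteq> 0" "\<And>i. i \<in> {1..6} \<Longrightarrow> \<rho> (E i) *v v = 0"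
    "\<And>i. i \<in> {1..6} \<Longrightarrow> \<rho> (H i) *v v = of_nat ([0, 0, 0, 0, 0, 1] ! (i - 1)) *s v"
    using V_weight unfolding irreducible_of_weight_def has_highest_weight_def by blast
  obtain u where u: "u \<in> U" "u \<noteq> 0"
    "\<And>i. i \<in> {1..6} \<Longrightarrow> tensor_rep \<rho> \<rho> (H i) *v u = of_nat ([0, 0, 0, 0, 0, 2] ! (i - 1)) *s u"
    using U_weight unfolding irreducible_of_weight_def has_highest_weight_def by blast
  obtain w where w: "w \<in> W" "w \<noteq> 0" "\<And>i. i \<in> {1..6} \<Longrightarrow> tensor_rep \<rho> \<rho> (E i) *v w = 0"
    "\<And>i. i \<in> {1..6} \<Longrightarrow> tensor_rep \<rho> \<rho> (H i) *v w = of_nat ([0, 0, 0, 0, 1, 0] ! (i - 1)) *s w"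
    using W_weight unfolding irreducible_of_weight_def has_highest_weight_def by blast
  \<comment> \<open>The weight of U pairs to 2 * 16, that of W to 30, the coefficient at node
    5.\<close>
  have hu: "tensor_rep \<rho> \<rho> g.height *v u = 32 *s u"
    using g.height_highest_weight[OF rep2 u(3)] unfolding sum_1_6 by (simp add: height_coeff_def)
  have hw: "tensor_rep \<rho> \<rho> g.height *v w = 30 *s w"
    using g.height_highest_weight[OF rep2 w(4)] unfolding sum_1_6 by (simp add: height_coeff_def)
  obtain PU PX PW where P: "PU + PX + PW = mat 1"
    "\<And>x. PU *v x \<in> U" "\<And>x. PX *v x \<in> Vstar" "\<And>x. PW *v x \<in> W"
    "\<And>x. x \<in> U \<Longrightarrow> PU *v x = x \<and> PX *v x = 0 \<and> PW *v x = 0"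
    "\<And>x. x \<in> Vstar \<Longrightarrow> PU *v x = 0 \<and> PX *v x = x \<and> PW *v x = 0"
    "\<And>x. x \<in> W \<Longrightarrow> PU *v x = 0 \<and> PX *v x = 0 \<and> PW *v x = x"
    by (rule direct_sum3_projections[OF decomposition sub]) blast
  interpret sq: e6_square br E F H \<rho> v xs ys U Vstar W PU PX PW u w
    by unfold_locales (use V_rep irr v g.lie_alg dual V_dim P Vstar_dual u(1,2) hu w hw in auto)
  have split: "x = PU *v x + PX *v x + PW *v x" for x by (rule sq.split)
  have projX: "projection Vstar (subspace_sum U W) = PX"
  proof (rule projection_eqI)
    show "\<exists>y\<in>Vstar. \<exists>z\<in>subspace_sum U W. x = y + z" for x
    proof -
      have "PU *v x + PW *v x \<in> subspace_sum U W"
        unfolding subspace_sum_def using P(2-4) by blast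
      moreover have "x = PX *v x + (PU *v x + PW *v x)"
        by (subst split) (simp only: add_ac)
      ultimately show ?thesis using P(2-4) by blast
    qed
  qed (use P in \<open>auto simp: subspace_sum_def matrix_vector_right_distrib\<close>)
  have projU: "projection U (subspace_sum Vstar W) = PU"
  proof (rule projection_eqI)
    show "\<exists>y\<in>U. \<exists>z\<in>subspace_sum Vstar W. x = y + z" for x
    proof -
      have "PX *v x + PW *v x \<in> subspace_sum Vstar W"
        unfolding subspace_sum_def using P(2-4) by blast
      moreover have "x = PU *v x + (PX *v x + PW *v x)"
        by (subst split) (simp only: add_ac)
      ultimately show ?thesis using P(2-4) by blast
    qed
  qed (use P in \<open>auto simp: subspace_sum_def matrix_vector_right_distrib\<close>)
  define t where "t = 1 / (72 * h)"
  \<comment> \<open>\<open>p\<close> is the inverse of q and is itself a power series, so all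
    exponents can be handled before passing to Laurent series.\<close>
  define p where "p = fps_exp t oo fps_X ^ 2"
  have q_series: "q_series h = fps_exp (- t) oo fps_X ^ 2"
    by (simp add: q_series_def t_def)
  let ?M = "(- 1 / (2 * h)) *sm Omega \<rho> xs ys"
  have "sq.acts ?M (2 * - t) (13 * t) t"
    using sq.acts_smult[OF sq.acts_flip_Omega(2), of "- 1 / (2 * h)"] by (simp add: t_def)
  then have pow: "mat_power ?M k = (2 * - t) ^ k *sm PU + (13 * t) ^ k *sm PX + t ^ k *sm PW" for k
    by (intro sq.acts_eq sq.acts_mat_power)
  have "fps_const (- 1 / 2) * (fps_X ^ 2 * fps_const (1 / h) * fps_const z) = fps_X ^ 2 * fps_const (- 1 / (2 * h) * z)" for z
  proof -
    have "- 1 / (2 * h) * z = (- 1 / 2) * ((1 / h) * z)" by simp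
    then show ?thesis by (simp only: fps_const_mult[symmetric] ac_simps)
  qed
  then have "fps_const (- 1 / 2) *sm Theta h \<rho> xs ys = fps_X ^ 2 *sm map_matrix fps_const ?M"
    unfolding Theta_def vec_eq_iff nth_map_matrix by blast
  then have exp: "mat_exp (fps_const (- 1 / 2) *sm Theta h \<rho> xs ys) =
      (q_series h ^ 2) *sm map_matrix fps_const PU + (p ^ 13) *sm map_matrix fps_const PX + p *sm map_matrix fps_const PW"
    using mat_exp_eq_projections[of "fps_X ^ 2", OF _ pow]
      fps_exp_compose_power[of 2 "- t"] fps_exp_compose_power[of 13 t]
    by (simp add: p_def q_series)
  have neg: "(- A) *v x = - (A *v x)" for A :: "complex ^ ('n \<times> 'n) ^ ('n \<times> 'n)" and x
    by (simp add: vec_eq_iff matrix_vector_mult_def sum_negf)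
  have flip_P: "flip ** PU = PU" "flip ** PX = PX" "flip ** PW = - PW"
    using sq.acts_flip_Omega(1) P(2-4)
    by (simp_all add: matrix_eq sq.acts_def neg flip: matrix_vector_mul_assoc)
  have flip_fps: "flip = (map_matrix fps_const flip :: complex fps ^ ('n \<times> 'n) ^ ('n \<times> 'n))"
    by (simp add: vec_eq_iff flip_def)
  have X: "I X_plus = (q_series h ^ 2) *sm map_matrix fps_const PU + (p ^ 13) *sm map_matrix fps_const PX
      - p *sm map_matrix fps_const PW"
    unfolding I_X_plus exp flip_fps matrix_add_ldistrib smult_mat_mult_right map_matrix_fps_const_mult flip_P
    by (simp add: vec_eq_iff flip: fps_const_neg)
  \<comment> \<open>Eliminating this projection is what leaves a relation among the crossing, the
    identity and the two merged tangles.\<close>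
  have PW: "PW = mat 1 - PU - PX" using P(1) by (simp add: algebra_simps)
  have pq: "p * q_series h = 1"
    unfolding p_def q_series
    by (simp flip: fps_compose_mult_distrib fps_exp_add_mult)
  then have "fps_to_fls p * q = 1"
    unfolding q by (metis fls_times_fps_to_fls fps_one_to_fls)
  then have inv: "inverse q = fps_to_fls p"
    by (metis inverse_unique mult.commute)
  have q1: "q powi -1 = fps_to_fls p" "q powi -13 = fps_to_fls p ^ 13" "q powi 2 = q ^ 2"
    by (simp_all add: power_int_def inv)
  have cancel: "z * fps_to_fls (y * fps_const a) / fps_to_fls y = z * fps_to_fls (fps_const a)"
    if "y \<noteq> 0" for z y and a :: complex
    using that by (simp add: fls_times_fps_to_fls del: fps_const_to_fls)
  \<comment> \<open>The skein relation for one matrix entry: \<open>a\<close>, \<open>b\<close>,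
    \<open>d\<close> stand for the entries of \<open>PU\<close>, \<open>PX\<close> and the
    identity.\<close>
  have "fps_to_fls (q_series h ^ 2 * fps_const a + p ^ 13 * fps_const b - p * fps_const (d - a - b))
      = - fps_to_fls p * fps_to_fls (fps_const d) + (fps_to_fls p + fps_to_fls p ^ 13) * fps_to_fls (fps_const b)
        + (fps_to_fls p + q ^ 2) * fps_to_fls (fps_const a)" for a b d :: complex
    by (simp add: q fls_times_fps_to_fls fps_to_fls_power algebra_simps
        del: fps_const_to_fls flip: fps_const_sub fps_const_add)
  then show ?thesis
    unfolding X I_Id I_H I_H_do projX projU q1 PW map_matrix_fps_const_mat_1[symmetric]
    by (simp add: vec_eq_iff cancel[OF r_nonzero] cancel[OF s_nonzero] del: fps_const_to_fls)
qed

end
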